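(* Let $n \geq 2$ and let $k \in \{1,2,\dots,n-1\}$. (i) If $k$ is even, then $S_k$ generates $\text{Möb}^{+}(n)$ and $$\frac{n(n+1)}{2k(n-k+1)} \leq |\text{Möb}^{+}(n)|_k \leq 2n+4.$$ (ii) If $k$ is odd, then $S_k$ generates $\text{Möb}(n)$ and $$\frac{n(n+1)}{2k(n-k+1)} \leq |\text{Möb}^{+}(n)|_k \leq 2n+2+k.$$
   Context: $\mathbb{H}^n$ is hyperbolic $n$-space, $\text{Möb}(n)$ is its full isometry group, and $\text{Möb}^{+}(n)$ is the subgroup of orientation preserving isometries. An involution is an isometry of $\mathbb{H}^n$ of order two; its fixed point set is a totally geodesic subspace. A $k$-involution is an involution whose fixed point set has codimension $k$, and $S_k \subset \text{Möb}(n)$ is the set (a conjugacy class) of all $k$-involutions. A $k$-involution is orientation reversing if and only if $k$ is odd. Let $G$ be a group and $S$ a symmetric set of generators of a group containing $G$ ($S$ need not be a subset of $G$, but every element of $G$ is a product of elements of $S$). For $g\in G$, the $S$-length of $g$ is the minimal number of elements of $S$ needed to express $g$ as their product. The $S$-length of $G$ is the supremum of the $S$-lengths of all $g \in G$. $|G|_k$ denotes the $S_k$-length of $G$. *)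

theory Defs
  imports "HOL-Analysis.Analysis" "HOL-Algebra.Bij" "HOL-Algebra.Generated_Groups"
begin

section \<open>Word length with respect to a generating set\<close>

text \<open>The infimum over the empty set is \<open>\<infinity>\<close>, so an element that is no product of elements
  of \<open>S\<close> has infinite length. The empty product is allowed and represents the identity.\<close>

definition word_length :: "('a, 'b) monoid_scheme \<Rightarrow> 'a set \<Rightarrow> 'a \<Rightarrow> enat" where
  "word_length M S g =
     (INF xs \<in> {xs \<in> lists S. foldr (mult M) xs (one M) = g}. enat (length xs))"

definition set_length :: "('a, 'b) monoid_scheme \<Rightarrow> 'a set \<Rightarrow> 'a set \<Rightarrow> enat" where
  "set_length M S G = (SUP g \<in> G. word_length M S g)"

section \<open>Hyperbolic space and its isometries\<close>

text \<open>Hyperbolic \<open>n\<close>-space with \<open>n = CARD('n)\<close>, in the projective (Klein) model on the open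
  unit ball. A point \<open>x\<close> stands for the point \<open>(1, x) / sqrt (1 - x \<bullet> x)\<close> of the hyperboloid,
  and the distance below is the inverse hyperbolic cosine of the negated Lorentz product of
  two such points.\<close>

definition hspace :: "(real ^ 'n) set" where
  "hspace = ball 0 1"

definition hdist :: "real ^ 'n \<Rightarrow> real ^ 'n \<Rightarrow> real" where
  "hdist x y = arcosh ((1 - x \<bullet> y) / sqrt ((1 - x \<bullet> x) * (1 - y \<bullet> y)))"

text \<open>Following \<^const>\<open>BijGroup\<close>, self-maps of the ball are extensional: they are
  \<^const>\<open>undefined\<close> off the ball.\<close>

definition hisometries :: "(real ^ 'n \<Rightarrow> real ^ 'n) set" where
  "hisometries =
     {f \<in> Bij hspace. \<forall>x \<in> hspace. \<forall>y \<in> hspace. hdist (f x) (f y) = hdist x y}"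

definition Mob :: "(real ^ 'n \<Rightarrow> real ^ 'n) monoid" where
  "Mob = BijGroup hspace \<lparr>carrier := hisometries\<rparr>"

text \<open>The ball is a global chart, so orientation is read off from the Jacobian determinant.\<close>

definition orientation_preserving :: "(real ^ 'n \<Rightarrow> real ^ 'n) \<Rightarrow> bool" where
  "orientation_preserving f \<longleftrightarrow>
     (\<forall>x \<in> hspace. \<exists>f'. (f has_derivative f') (at x) \<and> det (matrix f') > 0)"

definition Mob_plus :: "(real ^ 'n \<Rightarrow> real ^ 'n) set" where
  "Mob_plus = {f \<in> carrier Mob. orientation_preserving f}"

section \<open>Involutions\<close>

text \<open>In the Klein model the totally geodesic subspaces are exactly the nonempty intersections of
  the ball with affine subspaces, and the dimensions agree.\<close>

definition geodesic_subspace_codim :: "nat \<Rightarrow> (real ^ 'n) set \<Rightarrow> bool" where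
  "geodesic_subspace_codim k F \<longleftrightarrow>
     (\<exists>A. affine A \<and> aff_dim A = int CARD('n) - int k \<and> A \<inter> hspace \<noteq> {} \<and> F = A \<inter> hspace)"

definition involutions :: "nat \<Rightarrow> (real ^ 'n \<Rightarrow> real ^ 'n) set" where
  "involutions k =
     {f \<in> carrier Mob. f \<noteq> \<one>\<^bsub>Mob\<^esub> \<and> f \<otimes>\<^bsub>Mob\<^esub> f = \<one>\<^bsub>Mob\<^esub> \<and>
        geodesic_subspace_codim k {x \<in> hspace. f x = x}}"

section \<open>The isometries form a group\<close>

lemma subgroup_hisometries: "subgroup hisometries (BijGroup (hspace :: (real ^ 'n) set))"
proof -
  interpret B: group "BijGroup (hspace :: (real ^ 'n) set)"
    by (rule group_BijGroup)
  show ?thesis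
  proof (rule B.subgroupI)
    show "hisometries \<subseteq> carrier (BijGroup (hspace :: (real ^ 'n) set))"
      by (auto simp: hisometries_def BijGroup_def)
    have "(\<lambda>x \<in> hspace. x) \<in> (hisometries :: (real ^ 'n \<Rightarrow> real ^ 'n) set)"
      by (simp add: hisometries_def id_Bij)
    then show "(hisometries :: (real ^ 'n \<Rightarrow> real ^ 'n) set) \<noteq> {}"
      by blast
  next
    fix f :: "real ^ 'n \<Rightarrow> real ^ 'n"
    assume f: "f \<in> hisometries"
    then have bij: "f \<in> Bij hspace" "bij_betw f hspace hspace"
      by (auto simp: hisometries_def Bij_def)
    let ?g = "inv_into hspace f"
    have "hdist (?g x) (?g y) = hdist x y" if "x \<in> hspace" "y \<in> hspace" for x y
    proof -
      have "?g x \<in> hspace" "?g y \<in> hspace" "f (?g x) = x" "f (?g y) = y"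
        using bij(2) that
        by (auto simp: bij_betw_inv_into_right bij_betw_apply[OF bij_betw_inv_into])
      then show ?thesis
        using f by (fastforce simp: hisometries_def)
    qed
    then show "inv\<^bsub>BijGroup hspace\<^esub> f \<in> hisometries"
      using bij(1) by (simp add: inv_BijGroup hisometries_def restrict_inv_into_Bij)
  next
    fix f g :: "real ^ 'n \<Rightarrow> real ^ 'n"
    assume fg: "f \<in> hisometries" "g \<in> hisometries"
    then have bij: "f \<in> Bij hspace" "g \<in> Bij hspace" "bij_betw g hspace hspace"
      by (auto simp: hisometries_def Bij_def)
    have "hdist (f (g x)) (f (g y)) = hdist x y" if "x \<in> hspace" "y \<in> hspace" for x y
      using fg that bij_betw_apply[OF bij(3)] by (simp add: hisometries_def)
    then show "f \<otimes>\<^bsub>BijGroup hspace\<^esub> g \<in> hisometries"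
      using bij by (simp add: BijGroup_def hisometries_def compose_Bij compose_eq)
  qed
qed

lemma group_Mob: "group Mob"
  unfolding Mob_def using subgroup_hisometries group_BijGroup
  by (rule subgroup.subgroup_is_group)

end

theory Submission
  imports Defs
begin

text \<open>Everything is linear algebra in the Lorentz space \<open>\<real> \<times> \<real>\<^sup>n\<close>. A linear map that preserves
the Lorentz form and the upper light cone acts projectively on the ball, and this action is
faithful and isometric (\<open>klein_inj\<close>, \<open>klein_isometry\<close>).

The upper bound starts from the classical fact that every isometry is a product of at
most \<open>n + 1\<close> reflections (\<open>isometry_is_product_of_reflections\<close>): the images of \<open>n + 1\<close> points
in general position determine the isometry, and each point costs at most one reflection. A
reflection reverses the orientation, so an orientation preserving isometry is a product of an
even number of reflections. The key step is that two reflections in spacelike unit vectors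
\<open>a\<close>, \<open>b\<close> can be traded for two \<open>k\<close>-involutions (\<open>two_reflections_eq_two_involutions\<close>). Since
\<open>k - 1 \<le> n - 2\<close>, there is an orthonormal family of \<open>k - 1\<close> vectors of \<open>\<real>\<^sup>n\<close> orthogonal to both
\<open>a\<close> and \<open>b\<close>; if \<open>\<rho>\<close> is the product of the reflections in them, then the product of the
reflections in \<open>a\<close> and \<open>b\<close> is \<open>(R\<^sub>a \<rho>) (\<rho> R\<^sub>b)\<close>, and both factors are \<open>k\<close>-involutions. Hence
the length of the orientation preserving group is at most \<open>n + 1\<close>, which is below both bounds
claimed. It follows also that \<open>k\<close>-involutions generate all orientation preserving isometries;
each of them is a product of \<open>k\<close> reflections, so for even \<open>k\<close> they generate nothing else, and
for odd \<open>k\<close> multiplication by one of them turns an orientation reversing isometry into an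
orientation preserving one.

The lower bound compares eigenspaces. The linear map of a \<open>k\<close>-involution has a fixed
space of codimension \<open>k\<close> and a \<open>-1\<close> eigenspace of codimension \<open>n + 1 - k\<close>. For a product \<open>G\<close>
of \<open>m\<close> of them, the spaces \<open>ker (G - 1)\<close> and \<open>ker (G - (-1)\<^sup>m)\<close> therefore have codimension at
most \<open>m k\<close> and \<open>m (n + 1 - k)\<close>, respectively. There is an orientation preserving \<open>G\<close> whose
eigenspaces for \<open>1\<close> and \<open>-1\<close> are at most one-dimensional
(\<open>exists_isometry_with_small_eigenspaces\<close>), so that \<open>n \<le> m k\<close> and \<open>n \<le> m (n + 1 - k)\<close>. The
claim is \<open>n (n + 1) \<le> 2 m k (n + 1 - k)\<close>. It follows by multiplying the first inequality by \<open>n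
+ 1 \<le> 2 (n + 1 - k)\<close> or the second one by \<open>n + 1 \<le> 2 k\<close>; at least one of these two bounds on
\<open>k\<close> is true.\<close>

section \<open>The Lorentz form and the hyperboloid\<close>

text \<open>The first component is the time coordinate. The form is negative on it and positive on
  the space coordinates, so the points of the ball correspond to the timelike lines.\<close>

definition lform :: "real \<times> (real ^ 'n) \<Rightarrow> real \<times> (real ^ 'n) \<Rightarrow> real" where
  "lform u w = snd u \<bullet> snd w - fst u * fst w"

lemma lform_commute: "lform u w = lform w u"
  by (simp add: lform_def inner_commute)

lemma lform_simps [simp]:
  "lform (u + v) w = lform u w + lform v w"
  "lform w (u + v) = lform w u + lform w v"
  "lform (u - v) w = lform u w - lform v w"
  "lform w (u - v) = lform w u - lform w v"
  "lform (c *\<^sub>R u) w = c * lform u w"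
  "lform w (c *\<^sub>R u) = c * lform w u"
  "lform (- u) w = - lform u w"
  "lform w (- u) = - lform w u"
  "lform 0 w = 0" "lform w 0 = 0"
  by (simp_all add: lform_def inner_simps algebra_simps)

lemma lform_sum_left: "lform (sum f A) w = (\<Sum>a\<in>A. lform (f a) w)"
  by (induction A rule: infinite_finite_induct) auto

lemma lform_nondegenerate:
  assumes "\<And>w. lform u w = 0"
  shows "u = 0"
proof -
  have "fst u = 0" "snd u = 0"
    using assms[of "(1, 0)"] assms[of "(0, snd u)"] by (auto simp: lform_def)
  then show ?thesis
    by (simp add: prod_eq_iff)
qed

lemma mem_hspace: "x \<in> hspace \<longleftrightarrow> x \<bullet> x < 1"
  by (simp add: hspace_def norm_lt_square)

lemma zero_in_hspace [simp]: "0 \<in> hspace"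
  by (simp add: mem_hspace)

lemma open_hspace: "open (hspace :: (real ^ 'n) set)"
  by (simp add: hspace_def)

definition proj :: "real \<times> (real ^ 'n) \<Rightarrow> real ^ 'n" where
  "proj u = snd u /\<^sub>R fst u"

text \<open>The point of the upper sheet \<open>lform u u = -1\<close> of the hyperboloid on the ray through \<open>(1,
  x)\<close>. Projective maps of the ball become linear on these representatives.\<close>

definition hyp :: "real ^ 'n \<Rightarrow> real \<times> (real ^ 'n)" where
  "hyp x = (1 / sqrt (1 - x \<bullet> x)) *\<^sub>R (1, x)"

lemma fst_hyp_pos: "x \<in> hspace \<Longrightarrow> 0 < fst (hyp x)"
  by (simp add: hyp_def mem_hspace)

lemma proj_hyp: "x \<in> hspace \<Longrightarrow> proj (hyp x) = x"
  by (simp add: proj_def hyp_def mem_hspace)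

lemma lform_hyp:
  assumes "x \<in> hspace" "y \<in> hspace"
  shows "lform (hyp x) (hyp y) = - ((1 - x \<bullet> y) / sqrt ((1 - x \<bullet> x) * (1 - y \<bullet> y)))"
proof -
  have "lform (hyp x) (hyp y)
      = 1 / sqrt (1 - x \<bullet> x) * (1 / sqrt (1 - y \<bullet> y) * lform (1, x) (1, y))"
    by (simp only: hyp_def lform_simps mult.left_commute)
  then show ?thesis
    by (simp add: lform_def real_sqrt_mult minus_divide_left)
qed

lemma lform_hyp_self: "x \<in> hspace \<Longrightarrow> lform (hyp x) (hyp x) = -1"
  by (simp add: lform_hyp mem_hspace)

lemma hyp_eq_iff: "x \<in> hspace \<Longrightarrow> y \<in> hspace \<Longrightarrow> hyp x = hyp y \<longleftrightarrow> x = y"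
  by (metis proj_hyp)

lemma timelike_proj:
  assumes "0 < fst u" "lform u u < 0"
  shows "proj u \<in> hspace" "u = fst u *\<^sub>R (1, proj u)"
proof -
  have "snd u \<bullet> snd u < fst u * fst u"
    using assms by (simp add: lform_def)
  then show "proj u \<in> hspace"
    using assms(1) by (simp add: proj_def mem_hspace field_simps)
  show "u = fst u *\<^sub>R (1, proj u)"
    using assms(1) by (simp add: proj_def prod_eq_iff)
qed

lemma hyp_proj:
  assumes "0 < fst u" "lform u u = -1"
  shows "hyp (proj u) = u"
proof -
  have "snd u \<bullet> snd u = fst u * fst u - 1"
    using assms by (simp add: lform_def)
  then have "1 - proj u \<bullet> proj u = (1 / fst u)\<^sup>2"
    using assms(1) by (simp add: proj_def field_simps power2_eq_square)
  then have "sqrt (1 - proj u \<bullet> proj u) = 1 / fst u"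
    using assms(1) by (metis real_sqrt_unique less_imp_le zero_less_divide_1_iff)
  then show ?thesis
    using assms(1) by (simp add: hyp_def proj_def prod_eq_iff)
qed

text \<open>This identity makes the reversed Cauchy-Schwarz inequality for timelike vectors strict:
  for points \<open>x \<noteq> y\<close> of the ball the first summand on the right is positive.\<close>

lemma reversed_cauchy_schwarz:
  fixes x y :: "real ^ 'n"
  shows "(1 - x \<bullet> y)\<^sup>2 - (1 - x \<bullet> x) * (1 - y \<bullet> y)
           = (1 - x \<bullet> x) * ((x - y) \<bullet> (x - y)) + (x \<bullet> (y - x))\<^sup>2"
  by (simp add: inner_simps inner_commute power2_eq_square algebra_simps)

lemma inner_less_one: "x \<in> hspace \<Longrightarrow> y \<in> hspace \<Longrightarrow> x \<bullet> y < 1"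
proof -
  assume "x \<in> hspace" "y \<in> hspace"
  then have "norm x * norm y < 1 * 1"
    unfolding hspace_def by (intro mult_strict_mono') auto
  then show ?thesis
    using norm_cauchy_schwarz[of x y] by linarith
qed

lemma lform_hyp_less:
  assumes "x \<in> hspace" "y \<in> hspace" "x \<noteq> y"
  shows "lform (hyp x) (hyp y) < -1"
proof -
  have "0 < (1 - x \<bullet> x) * ((x - y) \<bullet> (x - y))"
    using assms by (simp add: mem_hspace)
  then have "(1 - x \<bullet> x) * (1 - y \<bullet> y) < (1 - x \<bullet> y)\<^sup>2"
    using reversed_cauchy_schwarz[of x y] by (smt (verit) zero_le_power2)
  then have "sqrt ((1 - x \<bullet> x) * (1 - y \<bullet> y)) < 1 - x \<bullet> y"
    using inner_less_one[OF assms(1,2)] by (intro real_less_lsqrt) auto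
  moreover have "0 < sqrt ((1 - x \<bullet> x) * (1 - y \<bullet> y))"
    using assms by (simp add: mem_hspace)
  ultimately show ?thesis
    using assms by (simp add: lform_hyp field_simps)
qed

lemma hdist_eq_arcosh:
  assumes "x \<in> hspace" "y \<in> hspace"
  shows "hdist x y = arcosh (- lform (hyp x) (hyp y))"
  using assms by (simp add: hdist_def lform_hyp)

text \<open>The hyperbolic distance is \<^const>\<open>arcosh\<close> of a number that is at least \<open>1\<close>, and \<^const>\<open>arcosh\<close> is
  injective there. So isometries are the maps of the hyperboloid that preserve the Lorentz form.\<close>

lemma hdist_eq_iff:
  assumes "x \<in> hspace" "y \<in> hspace" "x' \<in> hspace" "y' \<in> hspace"
  shows "hdist x y = hdist x' y' \<longleftrightarrow> lform (hyp x) (hyp y) = lform (hyp x') (hyp y')"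
proof -
  have ge: "1 \<le> - lform (hyp x) (hyp y)" if "x \<in> hspace" "y \<in> hspace" for x y :: "real ^ 'n"
    using that lform_hyp_less[OF that] lform_hyp_self[OF that(1)] by (cases "x = y") auto
  show ?thesis
    unfolding hdist_eq_arcosh[OF assms(1,2)] hdist_eq_arcosh[OF assms(3,4)]
    using ge[OF assms(1,2)] ge[OF assms(3,4)]
    by (metis cosh_arcosh_real minus_minus)
qed

section \<open>Lorentz transformations act on the ball by isometries\<close>

text \<open>The last clause excludes maps such as \<open>u \<mapsto> -u\<close> that exchange the two sheets of the
  hyperboloid; without it the projective action would not determine the linear map.\<close>

definition lorentz :: "(real \<times> (real ^ 'n) \<Rightarrow> real \<times> (real ^ 'n)) \<Rightarrow> bool" where
  "lorentz L \<longleftrightarrow> linear L \<and> (\<forall>u w. lform (L u) (L w) = lform u w) \<and>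
     (\<forall>x \<in> hspace. 0 < fst (L (1, x)))"

definition klein :: "(real \<times> (real ^ 'n) \<Rightarrow> real \<times> (real ^ 'n)) \<Rightarrow> real ^ 'n \<Rightarrow> real ^ 'n" where
  "klein L = (\<lambda>x \<in> hspace. proj (L (1, x)))"

lemma lorentzD:
  assumes "lorentz L"
  shows "linear L" "lform (L u) (L w) = lform u w" "x \<in> hspace \<Longrightarrow> 0 < fst (L (1, x))"
  using assms unfolding lorentz_def by blast+

lemma lorentz_inj:
  assumes "lorentz L"
  shows "inj L"
  unfolding linear_injective_0[OF lorentzD(1)[OF assms]]
proof (intro allI impI)
  fix u assume "L u = 0"
  then have "lform u w = 0" for w
    using lorentzD(2)[OF assms, of u w] by simp
  then show "u = 0"
    by (rule lform_nondegenerate)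
qed

lemma lorentz_surj: "lorentz L \<Longrightarrow> surj L"
  using linear_injective_imp_surjective lorentz_inj lorentzD(1) by blast

lemma lorentz_proj_mem: "lorentz L \<Longrightarrow> x \<in> hspace \<Longrightarrow> proj (L (1, x)) \<in> hspace"
  by (rule timelike_proj) (auto simp: lorentzD, simp add: lform_def mem_hspace)

lemma klein_mem: "lorentz L \<Longrightarrow> x \<in> hspace \<Longrightarrow> klein L x \<in> hspace"
  by (simp add: klein_def lorentz_proj_mem)

text \<open>A Lorentz transformation preserves the normalisation \<open>lform u u = -1\<close>, so on
  representatives in the hyperboloid its action needs no rescaling.\<close>

lemma hyp_klein:
  assumes "lorentz L" "x \<in> hspace"
  shows "hyp (klein L x) = L (hyp x)"
proof -
  have sc: "L (hyp x) = (1 / sqrt (1 - x \<bullet> x)) *\<^sub>R L (1, x)"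
    unfolding hyp_def using lorentzD(1)[OF assms(1)] by (rule linear_scale)
  have "0 < fst (L (hyp x))"
    using assms by (simp add: sc lorentzD mem_hspace)
  moreover have "lform (L (hyp x)) (L (hyp x)) = -1"
    using assms by (simp add: lorentzD lform_hyp_self)
  ultimately have "hyp (proj (L (hyp x))) = L (hyp x)"
    by (rule hyp_proj)
  moreover have "proj (L (hyp x)) = klein L x"
    using assms by (simp add: sc proj_def klein_def mem_hspace divide_inverse)
  ultimately show ?thesis by simp
qed

lemma klein_fixed_iff:
  assumes "lorentz L" "x \<in> hspace"
  shows "klein L x = x \<longleftrightarrow> L (1, x) = (1, x)"
proof -
  have nz: "1 / sqrt (1 - x \<bullet> x) \<noteq> 0"
    using assms(2) by (simp add: mem_hspace)
  have "klein L x = x \<longleftrightarrow> L (hyp x) = hyp x"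
    using assms by (metis hyp_eq_iff hyp_klein klein_mem)
  also have "\<dots> \<longleftrightarrow> L (1, x) = (1, x)"
    unfolding hyp_def linear_scale[OF lorentzD(1)[OF assms(1)]]
    using nz by (metis scaleR_left_imp_eq)
  finally show ?thesis .
qed

lemma lorentz_id [simp]: "lorentz (\<lambda>u. u)"
  by (simp add: lorentz_def linear_id[unfolded id_def])

lemma lorentz_comp:
  assumes "lorentz L" "lorentz M"
  shows "lorentz (\<lambda>u. L (M u))"
proof -
  have "0 < fst (L (M (1, x)))" if x: "x \<in> hspace" for x
  proof -
    let ?c = "fst (M (1, x))"
    have "M (1, x) = ?c *\<^sub>R (1, proj (M (1, x)))"
      using assms(2) x by (intro timelike_proj) (auto simp: lorentzD, simp add: lform_def mem_hspace)
    then have "L (M (1, x)) = ?c *\<^sub>R L (1, proj (M (1, x)))"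
      using linear_scale[OF lorentzD(1)[OF assms(1)]] by metis
    then show ?thesis
      using assms x by (simp add: lorentzD lorentz_proj_mem)
  qed
  then show ?thesis
    using assms linear_compose[of M L] by (simp add: lorentz_def o_def del: split_paired_All)
qed

lemma klein_comp:
  assumes "lorentz L" "lorentz M"
  shows "klein (\<lambda>u. L (M u)) = compose hspace (klein L) (klein M)"
proof
  fix x
  show "klein (\<lambda>u. L (M u)) x = compose hspace (klein L) (klein M) x"
  proof (cases "x \<in> hspace")
    case True
    have "hyp (klein (\<lambda>u. L (M u)) x) = hyp (klein L (klein M x))"
      using True assms by (simp add: hyp_klein lorentz_comp klein_mem)
    then show ?thesis
      using True assms by (simp add: hyp_eq_iff lorentz_comp klein_mem compose_eq)
  qed (simp add: klein_def compose_def)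
qed

text \<open>Two Lorentz transformations with the same action agree on the hyperboloid, which spans
  the whole space.\<close>

lemma klein_inj:
  fixes L M :: "real \<times> (real ^ 'n) \<Rightarrow> real \<times> (real ^ 'n)"
  assumes "lorentz L" "lorentz M" "klein L = klein M"
  shows "L = M"
proof -
  have lin: "linear L" "linear M"
    using assms lorentzD by auto
  have eq: "L (1, x) = M (1, x)" if x: "x \<in> hspace" for x
  proof -
    have "L (hyp x) = M (hyp x)"
      using assms x by (metis hyp_klein)
    then show ?thesis
      unfolding hyp_def linear_scale[OF lin(1)] linear_scale[OF lin(2)]
      using x by (auto simp: mem_hspace)
  qed
  show ?thesis
  proof
    fix u :: "real \<times> (real ^ 'n)"
    let ?c = "norm (snd u) + 1"
    let ?x = "snd u /\<^sub>R ?c"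
    have c: "?c > 0" by (simp add: add_nonneg_pos)
    have x: "?x \<in> hspace"
      using c by (simp add: hspace_def field_simps)
    have u: "u = ?c *\<^sub>R (1, ?x) + (fst u - ?c) *\<^sub>R (1, 0)"
      using c by (simp add: prod_eq_iff)
    show "L u = M u"
      by (subst (1 2) u)
        (simp add: linear_add[OF lin(1)] linear_scale[OF lin(1)] linear_add[OF lin(2)]
          linear_scale[OF lin(2)] eq[OF x] eq[OF zero_in_hspace] del: scaleR_Pair)
  qed
qed

text \<open>Preservation of the form gives preservation of the distance. For surjectivity, the
  preimage of a point of the upper sheet could a priori lie on the lower sheet; the sign clause
  in \<^const>\<open>lorentz\<close> excludes this.\<close>

lemma klein_isometry:
  assumes "lorentz L"
  shows "klein L \<in> hisometries"
proof -
  have "inj_on (klein L) hspace"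
  proof
    fix x y assume "x \<in> hspace" "y \<in> hspace" "klein L x = klein L y"
    then have "L (hyp x) = L (hyp y)"
      using assms by (metis hyp_klein)
    then show "x = y"
      using \<open>x \<in> hspace\<close> \<open>y \<in> hspace\<close> lorentz_inj[OF assms] by (simp add: inj_eq hyp_eq_iff)
  qed
  moreover have "y \<in> klein L ` hspace" if y: "y \<in> hspace" for y
  proof -
    obtain u where u: "hyp y = L u"
      using lorentz_surj[OF assms] by (metis surjD)
    have uu: "lform u u = -1"
      using lform_hyp_self[OF y] lorentzD(2)[OF assms] u by metis
    then have nz: "fst u \<noteq> 0"
      by (metis inner_ge_zero lform_def diff_zero mult_zero_left neg_0_le_iff_le not_one_le_zero)
    have p: "proj u \<in> hspace"
    proof -
      have "snd u \<bullet> snd u < fst u * fst u" "0 < fst u * fst u"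
        using uu nz by (auto simp: lform_def zero_less_mult_iff linorder_neq_iff)
      then show ?thesis
        by (simp add: proj_def mem_hspace field_simps)
    qed
    have "u = fst u *\<^sub>R (1, proj u)"
      using nz by (simp add: proj_def prod_eq_iff)
    then have Lu: "L u = fst u *\<^sub>R L (1, proj u)"
      using linear_scale[OF lorentzD(1)[OF assms]] by metis
    then have "0 < fst u * fst (L (1, proj u))"
      using fst_hyp_pos[OF y] u by simp
    then have "0 < fst u"
      using lorentzD(3)[OF assms p] by (simp add: zero_less_mult_iff)
    then have "hyp (proj u) = u"
      using uu by (rule hyp_proj)
    then have "hyp (klein L (proj u)) = hyp y"
      using u p assms by (simp add: hyp_klein)
    then show ?thesis
      using p y assms by (metis hyp_eq_iff imageI klein_mem)
  qed
  ultimately have "bij_betw (klein L) hspace hspace"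
    using klein_mem[OF assms] by (auto simp: bij_betw_def)
  then have "klein L \<in> Bij hspace"
    by (simp add: Bij_def klein_def)
  then show ?thesis
    using assms by (auto simp: hisometries_def hdist_eq_iff klein_mem hyp_klein lorentzD)
qed

lemma Mob_simps [simp]:
  "carrier Mob = hisometries"
  "\<one>\<^bsub>Mob\<^esub> = klein (\<lambda>u. u)"
  by (auto simp: Mob_def BijGroup_def klein_def proj_def)

lemma mult_Mob: "lorentz L \<Longrightarrow> lorentz M \<Longrightarrow> klein L \<otimes>\<^bsub>Mob\<^esub> klein M = klein (\<lambda>u. L (M u))"
  using klein_isometry[of L] klein_isometry[of M]
  by (simp add: Mob_def BijGroup_def klein_comp hisometries_def)

section \<open>Isometries are products of reflections\<close>

definition lrefl :: "real \<times> (real ^ 'n) \<Rightarrow> real \<times> (real ^ 'n) \<Rightarrow> real \<times> (real ^ 'n)" where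
  "lrefl a u = u - (2 * lform u a) *\<^sub>R a"

definition unit_spacelike :: "(real \<times> (real ^ 'n)) set" where
  "unit_spacelike = {a. lform a a = 1}"

lemma linear_lrefl: "linear (lrefl a)"
proof (rule linearI)
  show "lrefl a (u + w) = lrefl a u + lrefl a w" for u w
    by (simp add: lrefl_def scaleR_left_distrib distrib_left)
  show "lrefl a (c *\<^sub>R u) = c *\<^sub>R lrefl a u" for c u
    by (simp add: lrefl_def scaleR_right_diff_distrib mult.left_commute)
qed

lemma lform_lrefl: "a \<in> unit_spacelike \<Longrightarrow> lform (lrefl a u) (lrefl a w) = lform u w"
  by (simp add: lrefl_def unit_spacelike_def lform_commute[of a w] algebra_simps)

lemma lrefl_lrefl: "a \<in> unit_spacelike \<Longrightarrow> lrefl a (lrefl a u) = u"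
  by (simp add: lrefl_def unit_spacelike_def algebra_simps)

lemma lrefl_self: "a \<in> unit_spacelike \<Longrightarrow> lrefl a a = - a"
  by (simp add: lrefl_def unit_spacelike_def scaleR_2)

lemma lrefl_orthogonal: "lform u a = 0 \<Longrightarrow> lrefl a u = u"
  by (simp add: lrefl_def)

text \<open>The upper light cone is preserved because \<open>lform (lrefl a u) u = lform u u - 2 (lform u
  a)\<^sup>2\<close> is negative for timelike \<open>u\<close>, while vectors in opposite light cones have a positive
  product.\<close>

lemma lorentz_lrefl:
  assumes a: "a \<in> unit_spacelike"
  shows "lorentz (lrefl a)"
proof -
  have "0 < fst (lrefl a (1, x))" if x: "x \<in> hspace" for x
  proof (rule ccontr)
    let ?r = "lrefl a (1, x)"
    assume neg: "\<not> 0 < fst ?r"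
    have u: "lform (1, x) (1, x) < 0"
      using x by (simp add: lform_def mem_hspace)
    then have "lform ?r ?r < 0"
      using a by (simp add: lform_lrefl)
    then have "snd ?r \<bullet> snd ?r < (fst ?r)\<^sup>2"
      by (simp add: lform_def power2_eq_square)
    then have "(norm (snd ?r))\<^sup>2 < (fst ?r)\<^sup>2"
      by (simp only: power2_norm_eq_inner)
    then have n: "norm (snd ?r) < - fst ?r"
      using neg by (metis abs_of_nonpos not_less power2_less_imp_less power2_abs abs_ge_zero)
    have "norm (snd ?r) * norm x \<le> norm (snd ?r)"
      using x by (simp add: hspace_def mult_left_le)
    then have "0 < snd ?r \<bullet> x - fst ?r"
      using n Cauchy_Schwarz_ineq2[of "snd ?r" x] by linarith
    then have "0 < lform ?r (1, x)"
      by (simp add: lform_def)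
    moreover have "lform ?r (1, x) = lform (1, x) (1, x) - 2 * (lform (1, x) a)\<^sup>2"
      by (simp add: lrefl_def lform_commute[of a "(1, x)"] power2_eq_square)
    ultimately show False
      using u by (smt (verit) zero_le_power2)
  qed
  then show ?thesis
    using a by (auto simp: lorentz_def linear_lrefl lform_lrefl)
qed

lemma lorentz_refl_word: "set as \<subseteq> unit_spacelike \<Longrightarrow> lorentz (foldr lrefl as)"
proof (induction as)
  case (Cons a as)
  then show ?case
    using lorentz_comp[OF lorentz_lrefl[of a], of "foldr lrefl as"] by (simp add: o_def)
qed (simp add: id_def)

text \<open>The normal vector is the normalised difference \<open>hyp x - hyp y\<close>. This difference is
  spacelike, and it is orthogonal to exactly those vectors that have the same product with both
  points.\<close>

lemma exists_reflection_swapping: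
  assumes xy: "x \<in> hspace" "y \<in> hspace" "x \<noteq> y"
  obtains a where "a \<in> unit_spacelike" "lrefl a (hyp x) = hyp y"
    "\<And>u. lform u (hyp x) = lform u (hyp y) \<Longrightarrow> lrefl a u = u"
proof
  let ?d = "hyp x - hyp y"
  let ?l = "lform ?d ?d"
  define a where "a = (1 / sqrt ?l) *\<^sub>R ?d"
  have l: "?l = 2 * lform (hyp x) ?d"
    using xy by (simp add: lform_hyp_self lform_commute)
  have pos: "0 < ?l"
    using xy lform_hyp_less[OF xy] by (simp add: lform_hyp_self lform_commute)
  show "a \<in> unit_spacelike"
    using pos by (simp add: unit_spacelike_def a_def del: lform_simps(1-4))
  have refl: "lrefl a u = u - (2 * lform u ?d / ?l) *\<^sub>R ?d" for u
    using pos by (simp add: lrefl_def a_def del: lform_simps(1-4))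
  show "lrefl a (hyp x) = hyp y"
    unfolding refl l[symmetric] using pos by simp
  show "lrefl a u = u" if "lform u (hyp x) = lform u (hyp y)" for u
    using that by (simp add: refl)
qed

lemma hisometriesD:
  assumes "f \<in> hisometries"
  shows "x \<in> hspace \<Longrightarrow> f x \<in> hspace"
    and "x \<in> hspace \<Longrightarrow> y \<in> hspace \<Longrightarrow> lform (hyp (f x)) (hyp (f y)) = lform (hyp x) (hyp y)"
proof -
  show fx: "f x \<in> hspace" if "x \<in> hspace" for x
    using assms that by (auto simp: hisometries_def Bij_def bij_betw_def)
  show "lform (hyp (f x)) (hyp (f y)) = lform (hyp x) (hyp y)" if "x \<in> hspace" "y \<in> hspace"
    using assms that fx by (simp add: hisometries_def flip: hdist_eq_iff)
qed

text \<open>The new reflection moves the image of the new point \<open>q\<close> to \<open>f q\<close>. It fixes every earlier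
  point \<open>f p\<close>, because \<open>f p\<close> has the same distance from both.\<close>

lemma isometry_agrees_on_finite_set:
  assumes f: "f \<in> hisometries" and "finite P" "P \<subseteq> hspace"
  shows "\<exists>as. set as \<subseteq> unit_spacelike \<and> length as \<le> card P \<and>
           (\<forall>p\<in>P. klein (foldr lrefl as) p = f p)"
  using assms(2,3)
proof (induction P)
  case empty
  show ?case by (intro exI[of _ "[]"]) simp
next
  case (insert q P)
  then obtain as where as: "set as \<subseteq> unit_spacelike" "length as \<le> card P"
    "\<And>p. p \<in> P \<Longrightarrow> klein (foldr lrefl as) p = f p"
    by auto
  let ?L = "foldr lrefl as"
  have L: "lorentz ?L" using as(1) by (rule lorentz_refl_word)
  have q: "q \<in> hspace" and P: "p \<in> P \<Longrightarrow> p \<in> hspace" for p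
    using insert.prems by auto
  show ?case
  proof (cases "klein ?L q = f q")
    case True
    then show ?thesis
      using as insert.hyps by (intro exI[of _ as]) auto
  next
    case False
    then obtain a where a: "a \<in> unit_spacelike" "lrefl a (hyp (klein ?L q)) = hyp (f q)"
      "\<And>u. lform u (hyp (klein ?L q)) = lform u (hyp (f q)) \<Longrightarrow> lrefl a u = u"
      using exists_reflection_swapping[OF klein_mem[OF L q] hisometriesD(1)[OF f q]] by metis
    have aL: "lorentz (foldr lrefl (a # as))"
      using as(1) a(1) by (intro lorentz_refl_word) auto
    have step: "hyp (klein (foldr lrefl (a # as)) p) = lrefl a (hyp (klein ?L p))"
      if "p \<in> hspace" for p
      using that hyp_klein[OF aL that] hyp_klein[OF L that] by simp
    have "klein (foldr lrefl (a # as)) p = f p" if p: "p \<in> P" for p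
    proof -
      have "lform (hyp (f p)) (hyp (klein ?L q)) = lform (?L (hyp p)) (?L (hyp q))"
        using as(3)[OF p] hyp_klein[OF L P[OF p]] hyp_klein[OF L q] by simp
      also have "\<dots> = lform (hyp (f p)) (hyp (f q))"
        using p q P hisometriesD(2)[OF f] lorentzD(2)[OF L] by simp
      finally have "lrefl a (hyp (f p)) = hyp (f p)"
        by (rule a(3))
      then have "hyp (klein (foldr lrefl (a # as)) p) = hyp (f p)"
        using step[OF P[OF p]] as(3)[OF p] by simp
      then show ?thesis
        using P[OF p] klein_mem[OF aL] hisometriesD(1)[OF f] hyp_eq_iff by blast
    qed
    moreover have "klein (foldr lrefl (a # as)) q = f q"
      using step[OF q] a(2) q klein_mem[OF aL] hisometriesD(1)[OF f] hyp_eq_iff by metis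
    ultimately have "\<forall>p\<in>insert q P. klein (foldr lrefl (a # as)) p = f p"
      by blast
    moreover have "set (a # as) \<subseteq> unit_spacelike" "length (a # as) \<le> card (insert q P)"
      using as a(1) insert.hyps by auto
    ultimately show ?thesis
      by blast
  qed
qed

text \<open>The points \<open>0\<close> and \<open>e\<^sub>i / 2\<close> lie in the ball and the vectors \<open>(1, p)\<close> over them form a
  basis of the Lorentz space. The distances of \<open>f x\<close> from the images of these points therefore
  determine \<open>f x\<close>.\<close>

lemma isometry_is_product_of_reflections:
  fixes f :: "real ^ 'n \<Rightarrow> real ^ 'n"
  assumes f: "f \<in> hisometries"
  obtains as where "set as \<subseteq> unit_spacelike" "length as \<le> CARD('n) + 1"
    "f = klein (foldr lrefl as)"
proof -
  let ?P = "insert 0 (range (\<lambda>i. axis i (1/2))) :: (real ^ 'n) set"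
  have P: "?P \<subseteq> hspace"
    by (auto simp: mem_hspace inner_axis_axis)
  have "card (range (\<lambda>i. axis i (1/2)) :: (real ^ 'n) set) \<le> CARD('n)"
    by (rule card_image_le) simp
  then have card: "card ?P \<le> CARD('n) + 1"
    using card_insert_le_m1 by (simp add: card_insert_if)
  obtain as where as: "set as \<subseteq> unit_spacelike" "length as \<le> card ?P"
      "\<And>p. p \<in> ?P \<Longrightarrow> klein (foldr lrefl as) p = f p"
    using isometry_agrees_on_finite_set[OF f _ P] by auto
  let ?L = "foldr lrefl as"
  have L: "lorentz ?L" using as(1) by (rule lorentz_refl_word)
  have "f x = klein ?L x" if x: "x \<in> hspace" for x
  proof -
    obtain w where w: "hyp (f x) - L (hyp x) = L w" if "L = ?L" for L
      using lorentz_surj[OF L] by (metis surjD)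
    have orth: "lform w (hyp p) = 0" if p: "p \<in> ?P" for p
    proof -
      have ph: "p \<in> hspace" using p P by blast
      have "lform w (hyp p) = lform (?L w) (?L (hyp p))"
        using L by (simp add: lorentzD)
      also have "\<dots> = lform (hyp (f x) - ?L (hyp x)) (?L (hyp p))"
        by (simp add: w)
      also have "\<dots> = lform (hyp (f x)) (hyp (f p)) - lform (?L (hyp x)) (?L (hyp p))"
        using hyp_klein[OF L ph] as(3)[OF p] by simp
      also have "\<dots> = 0"
        using hisometriesD(2)[OF f x ph] lorentzD(2)[OF L] by simp
      finally show ?thesis .
    qed
    have sc: "lform w (1, p) = 0" if "p \<in> ?P" for p
    proof -
      have "1 - p \<bullet> p \<noteq> 0" using that P by (auto simp: mem_hspace)
      then show ?thesis
        using orth[OF that] unfolding hyp_def lform_simps(6) by simp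
    qed
    have "fst w = 0"
      using sc[of 0] by (simp add: lform_def)
    moreover have "snd w $ i = 0" for i
      using sc[of "axis i (1/2)"] \<open>fst w = 0\<close> by (simp add: lform_def inner_axis)
    ultimately have "w = 0"
      by (simp add: prod_eq_iff vec_eq_iff)
    then have "hyp (f x) = hyp (klein ?L x)"
      using w[OF refl] hyp_klein[OF L x] linear_0[OF lorentzD(1)[OF L]] by simp
    then show ?thesis
      using x hisometriesD(1)[OF f x] klein_mem[OF L x] by (simp add: hyp_eq_iff)
  qed
  moreover have "f x = klein ?L x" if "x \<notin> hspace" for x
    using f that by (simp add: klein_def hisometries_def Bij_def extensional_def)
  ultimately have "f = klein ?L"
    by blast
  then show ?thesis
    using as(1,2) card that by force
qed

section \<open>Orientation\<close>

text \<open>After a rotation that makes \<open>v\<close> a multiple of a basis vector \<open>e\<^sub>k\<close>, the update changes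
  only column \<open>k\<close> of the identity matrix, and Cramer's lemma evaluates the determinant.\<close>

lemma det_rank_one_update:
  fixes v w :: "real ^ 'n"
  shows "det (matrix (\<lambda>h. h + (h \<bullet> v) *\<^sub>R w)) = 1 + v \<bullet> w"
proof (cases "v = 0")
  case True
  then show ?thesis
    using matrix_id by (simp add: id_def)
next
  case False
  fix k :: 'n
  obtain Q where Q: "orthogonal_transformation Q" "Q (axis k (norm v)) = v"
    by (rule orthogonal_transformation_exists[of "axis k (norm v)" v])
      (simp_all add: norm_eq_sqrt_inner inner_axis_axis)
  have lQ: "linear Q" and Qi: "\<And>x y. Q x \<bullet> Q y = x \<bullet> y"
    using Q(1) by (auto simp: orthogonal_transformation_def)
  obtain w' where w': "w = Q w'"
    using orthogonal_transformation_surj[OF Q(1)] by (metis surjD)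
  let ?R = "\<lambda>h. h + (h \<bullet> v) *\<^sub>R w"
  let ?S = "\<lambda>h. h + (h \<bullet> axis k (norm v)) *\<^sub>R w'"
  have lin: "linear ?R" "linear ?S"
    by (auto intro!: linearI simp: algebra_simps inner_simps)
  have "?R \<circ> Q = Q \<circ> ?S"
    using Qi[of _ "axis k (norm v)"] lQ
    by (auto simp: fun_eq_iff w' Q(2) linear_add linear_scale)
  then have "matrix ?R ** matrix Q = matrix Q ** matrix ?S"
    using matrix_compose[OF lQ lin(1)] matrix_compose[OF lin(2) lQ] by simp
  then have "det (matrix ?R) * det (matrix Q) = det (matrix Q) * det (matrix ?S)"
    using arg_cong[of _ _ det] by (fastforce simp only: det_mul[symmetric])
  moreover have "det (matrix Q) \<noteq> 0"
    using Q(1) by (metis det_nz_iff_inj lQ orthogonal_transformation_inj)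
  ultimately have "det (matrix ?R) = det (matrix ?S)"
    by simp
  also have "matrix ?S =
      (\<chi> i j. if j = k then (mat 1 *v (axis k 1 + norm v *\<^sub>R w')) $ i else mat 1 $ i $ j)"
    unfolding matrix_vector_mul_lid
    by (simp add: matrix_def mat_def vec_eq_iff inner_axis) (auto simp: axis_def)
  also have "det \<dots> = (axis k 1 + norm v *\<^sub>R w') $ k * det (mat 1 :: real ^ 'n ^ 'n)"
    by (rule cramer_lemma)
  also have "\<dots> = 1 + axis k (norm v) \<bullet> w'"
    by (subst inner_axis') (simp add: axis_def)
  also have "\<dots> = 1 + v \<bullet> w"
    using Qi[of "axis k (norm v)" w'] Q(2) w' by simp
  finally show ?thesis .
qed

text \<open>For \<open>a = (\<alpha>, v)\<close> the reflection acts as \<open>x \<mapsto> (x - 2 s v) / D\<close> with \<open>s = x \<bullet> v - \<alpha>\<close> and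
  \<open>D = 1 - 2 s \<alpha> > 0\<close>. Its derivative is \<open>1 / D\<close> times a rank-one update of the identity, and
  the determinant is \<open>- 1 / D\<^bsup>n+1\<^esup>\<close>.\<close>

lemma klein_lrefl_derivative:
  fixes a :: "real \<times> (real ^ 'n)"
  assumes a: "a \<in> unit_spacelike" and x: "x \<in> hspace"
  shows "\<exists>f'. (klein (lrefl a) has_derivative f') (at x) \<and> det (matrix f') < 0"
proof -
  obtain \<alpha> v where av: "a = (\<alpha>, v)" by (cases a)
  have vv: "v \<bullet> v = 1 + \<alpha> * \<alpha>"
    using a by (simp add: unit_spacelike_def lform_def av)
  let ?s = "\<lambda>x. x \<bullet> v - \<alpha>"
  let ?D = "\<lambda>x. 1 - 2 * ?s x * \<alpha>"
  let ?w = "(2 * \<alpha> / ?D x) *\<^sub>R (x - (2 * ?s x) *\<^sub>R v) - 2 *\<^sub>R v"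
  let ?f' = "\<lambda>h. (1 / ?D x) *\<^sub>R (h + (h \<bullet> v) *\<^sub>R ?w)"
  have D: "0 < ?D x"
    using lorentzD(3)[OF lorentz_lrefl[OF a] x] by (simp add: lrefl_def lform_def av inner_commute)
  have kl: "klein (lrefl a) y = inverse (?D y) *\<^sub>R (y - (2 * ?s y) *\<^sub>R v)" if "y \<in> hspace" for y
    using that by (simp add: klein_def proj_def lrefl_def lform_def av inner_commute)
  let ?N = "\<lambda>y. y - (2 * ?s y) *\<^sub>R v"
  have dD: "(?D has_derivative (\<lambda>h. - (2 * (h \<bullet> v) * \<alpha>))) (at x)"
    and dN: "(?N has_derivative (\<lambda>h. h - (2 * (h \<bullet> v)) *\<^sub>R v)) (at x)"
    by (auto intro!: derivative_eq_intros)
  have "((\<lambda>y. inverse (?D y) *\<^sub>R ?N y) has_derivative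
      (\<lambda>h. inverse (?D x) *\<^sub>R (h - (2 * (h \<bullet> v)) *\<^sub>R v)
         + (- (inverse (?D x) * (- (2 * (h \<bullet> v) * \<alpha>)) * inverse (?D x))) *\<^sub>R ?N x)) (at x)"
    using D by (intro has_derivative_scaleR[OF Deriv.has_derivative_inverse[OF _ dD] dN]) simp
  moreover have "i *\<^sub>R (h - (2 * (h \<bullet> v)) *\<^sub>R v) + (- (i * (- (2 * (h \<bullet> v) * \<alpha>)) * i)) *\<^sub>R m
      = i *\<^sub>R (h + (h \<bullet> v) *\<^sub>R ((2 * \<alpha> * i) *\<^sub>R m - 2 *\<^sub>R v))" for i h m
    by (simp add: algebra_simps)
  ultimately have "((\<lambda>y. inverse (?D y) *\<^sub>R ?N y) has_derivative ?f') (at x)"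
    by (simp only: divide_inverse mult_1_left)
  then have "(klein (lrefl a) has_derivative ?f') (at x)"
    by (rule has_derivative_transform_within_open[OF _ open_hspace x]) (simp add: kl)
  moreover have "det (matrix ?f') = (1 / ?D x) ^ CARD('n) * (1 + v \<bullet> ?w)"
  proof -
    have lin: "linear (\<lambda>h. h + (h \<bullet> v) *\<^sub>R w)" "linear ((*\<^sub>R) c :: real ^ 'n \<Rightarrow> _)" for w c
      by (auto intro!: linearI simp: algebra_simps inner_simps)
    have "matrix ?f' = matrix ((*\<^sub>R) (1 / ?D x)) ** matrix (\<lambda>h. h + (h \<bullet> v) *\<^sub>R ?w)"
      using matrix_compose[OF lin] by (simp add: o_def)
    then show ?thesis
      by (simp only: det_mul det_matrix_scaleR det_rank_one_update)
  qed
  moreover have "1 + v \<bullet> ?w = - (1 / ?D x)"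
  proof -
    define p d where "p = x \<bullet> v" and "d = ?D x"
    have d: "d \<noteq> 0" "d = 1 - 2 * (p - \<alpha>) * \<alpha>"
      using D by (auto simp: d_def p_def)
    have "1 + v \<bullet> ?w = 1 + (2 * \<alpha> / d * (p - 2 * (p - \<alpha>) * (1 + \<alpha> * \<alpha>)) - 2 * (1 + \<alpha> * \<alpha>))"
      unfolding d_def p_def by (simp add: inner_diff_right vv inner_commute[of v x])
    also have "\<dots> = (d + 2 * \<alpha> * (p - 2 * (p - \<alpha>) * (1 + \<alpha> * \<alpha>)) - 2 * (1 + \<alpha> * \<alpha>) * d) / d"
      using d(1) by (simp add: field_simps)
    also have "d + 2 * \<alpha> * (p - 2 * (p - \<alpha>) * (1 + \<alpha> * \<alpha>)) - 2 * (1 + \<alpha> * \<alpha>) * d = -1"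
      unfolding d(2) by (simp add: algebra_simps)
    finally show ?thesis
      by (simp add: d_def)
  qed
  ultimately show ?thesis
    using D by (intro exI[of _ ?f']) (auto simp: zero_less_mult_iff mult_less_0_iff)
qed

text \<open>By the chain rule each reflection contributes one change of sign, at every point of the
  ball.\<close>

lemma refl_word_derivative:
  fixes as :: "(real \<times> (real ^ 'n)) list"
  assumes "set as \<subseteq> unit_spacelike" "x \<in> hspace"
  shows "\<exists>f'. (klein (foldr lrefl as) has_derivative f') (at x) \<and>
           0 < (-1) ^ length as * det (matrix f')"
  using assms(1)
proof (induction as)
  case Nil
  have "((\<lambda>y. y) has_derivative (\<lambda>h. h)) (at x)"
    by simp
  then have "(klein (foldr lrefl []) has_derivative (\<lambda>h. h)) (at x)"
    by (rule has_derivative_transform_within_open[OF _ open_hspace assms(2)])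
      (simp add: klein_def proj_def)
  then show ?case
    by (intro exI[of _ "\<lambda>h. h"]) (simp add: matrix_id[unfolded id_def] id_def)
next
  case (Cons a as)
  let ?L = "foldr lrefl as"
  have L: "lorentz ?L" and A: "lorentz (lrefl a)"
    using Cons.prems by (auto intro: lorentz_refl_word lorentz_lrefl)
  obtain f' where f': "(klein ?L has_derivative f') (at x)" "0 < (-1) ^ length as * det (matrix f')"
    using Cons by auto
  obtain g' where g': "(klein (lrefl a) has_derivative g') (at (klein ?L x))" "det (matrix g') < 0"
    using klein_lrefl_derivative[OF _ klein_mem[OF L assms(2)], of a] Cons.prems by auto
  have "((klein (lrefl a) \<circ> klein ?L) has_derivative (g' \<circ> f')) (at x)"
    using f'(1) g'(1) by (rule diff_chain_at)
  then have "(klein (foldr lrefl (a # as)) has_derivative (g' \<circ> f')) (at x)"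
    by (rule has_derivative_transform_within_open[OF _ open_hspace assms(2)])
      (simp add: klein_comp[OF A L] compose_def o_def)
  moreover have "matrix (g' \<circ> f') = matrix g' ** matrix f'"
    using f'(1) g'(1) by (intro matrix_compose) (auto dest: has_derivative_linear)
  then have "(-1) ^ length (a # as) * det (matrix (g' \<circ> f'))
      = - det (matrix g') * ((-1) ^ length as * det (matrix f'))"
    by (simp add: det_mul)
  then have "0 < (-1) ^ length (a # as) * det (matrix (g' \<circ> f'))"
    using mult_neg_pos[OF g'(2) f'(2)] by (simp add: mult.left_commute)
  ultimately show ?case
    by blast
qed

lemma orientation_preserving_refl_word:
  fixes as :: "(real \<times> (real ^ 'n)) list"
  assumes "set as \<subseteq> unit_spacelike"
  shows "orientation_preserving (klein (foldr lrefl as)) \<longleftrightarrow> even (length as)"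
proof
  assume "even (length as)"
  then show "orientation_preserving (klein (foldr lrefl as))"
    using refl_word_derivative[OF assms] unfolding orientation_preserving_def by fastforce
next
  assume "orientation_preserving (klein (foldr lrefl as))"
  then obtain f' where f': "(klein (foldr lrefl as) has_derivative f') (at 0)" "0 < det (matrix f')"
    using zero_in_hspace unfolding orientation_preserving_def by blast
  obtain g' where g': "(klein (foldr lrefl as) has_derivative g') (at 0)"
      "0 < (-1) ^ length as * det (matrix g')"
    using refl_word_derivative[OF assms zero_in_hspace] by blast
  have "f' = g'"
    using f'(1) g'(1) by (rule has_derivative_unique)
  then show "even (length as)"
    using f'(2) g'(2) by (cases "even (length as)") auto
qed

lemma refl_word_in_Mob_plus:
  assumes "set as \<subseteq> unit_spacelike"
  shows "klein (foldr lrefl as) \<in> Mob_plus \<longleftrightarrow> even (length as)"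
  using assms
  by (simp add: Mob_plus_def klein_isometry lorentz_refl_word orientation_preserving_refl_word)

section \<open>Involutions and their eigenspaces\<close>

text \<open>Every vector \<open>u\<close> is the sum of the fixed vector \<open>(u + L u) / 2\<close> and the negated vector
  \<open>(u - L u) / 2\<close>.\<close>

lemma eigenspace_dims_of_linear_involution:
  fixes L :: "real \<times> (real ^ 'n) \<Rightarrow> real \<times> (real ^ 'n)"
  assumes L: "linear L" and inv: "\<And>u. L (L u) = u"
  shows "dim {u. L u = u} + dim {u. L u = - u} = CARD('n) + 1"
proof -
  let ?S = "{u. L u = u}" and ?T = "{u. L u = - u}"
  have sub: "subspace ?S" "subspace ?T"
    using L by (auto simp: subspace_def linear_0 linear_add linear_scale)
  have "?S \<inter> ?T = {0}"
  proof -
    have "u = 0" if "u = - u" for u :: "real \<times> (real ^ 'n)"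
      using that by (simp add: prod_eq_iff vec_eq_iff)
    then show ?thesis
      using linear_0[OF L] by auto
  qed
  moreover have "{x + y |x y. x \<in> ?S \<and> y \<in> ?T} = UNIV"
  proof -
    have "u \<in> {x + y |x y. x \<in> ?S \<and> y \<in> ?T}" for u
    proof -
      have "u = (1/2) *\<^sub>R (u + L u) + (1/2) *\<^sub>R (u - L u)"
        by (simp flip: scaleR_right_distrib)
      moreover have "(1/2) *\<^sub>R (u + L u) \<in> ?S" "(1/2) *\<^sub>R (u - L u) \<in> ?T"
        using L by (simp_all add: linear_scale linear_add linear_diff inv add.commute
            flip: scaleR_minus_right)
      ultimately show ?thesis
        by blast
    qed
    then show ?thesis by blast
  qed
  ultimately show ?thesis
    using dim_sums_Int[OF sub] by simp
qed

text \<open>The ball is open, so \<open>A\<close> has the same affine dimension as the slice \<open>{x. (1, x) \<in> V}\<close> of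
  \<open>V\<close> at height \<open>1\<close>. This slice is a translate of the slice at height \<open>0\<close>, a hyperplane of \<open>V\<close>.\<close>

lemma aff_dim_of_geodesic_slice:
  fixes V :: "(real \<times> (real ^ 'n)) set"
  assumes V: "subspace V" and x0: "x0 \<in> hspace" "(1, x0) \<in> V"
    and A: "affine A" "A \<inter> hspace = {x \<in> hspace. (1, x) \<in> V}"
  shows "aff_dim A = int (dim V) - 1"
proof -
  let ?B = "{x. (1, x) \<in> V}" and ?W = "{w. (0, w) \<in> V}"
  have "affine ?B"
    unfolding affine_def
  proof (intro ballI allI impI)
    fix x y u v assume "x \<in> ?B" "y \<in> ?B" and uv: "u + v = (1::real)"
    then have "u *\<^sub>R (1, x) + v *\<^sub>R (1, y) \<in> V"
      using V by (intro subspace_add subspace_scale) auto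
    then show "u *\<^sub>R x + v *\<^sub>R y \<in> ?B"
      using uv by simp
  qed
  have AB: "A \<inter> hspace = ?B \<inter> hspace"
    using A(2) by auto
  have ne: "?B \<inter> hspace \<noteq> {}"
    using x0 by auto
  have "aff_dim A = aff_dim (A \<inter> hspace)"
    using ne AB A(1) by (intro aff_dim_convex_Int_open[symmetric] affine_imp_convex open_hspace) auto
  also have "\<dots> = aff_dim (?B \<inter> hspace)"
    by (simp only: AB)
  also have "\<dots> = aff_dim ?B"
    using ne \<open>affine ?B\<close> by (intro aff_dim_convex_Int_open affine_imp_convex open_hspace)
  also have "?B = (+) x0 ` ?W"
  proof -
    have "x \<in> (+) x0 ` ?W" if "(1, x) \<in> V" for x
      using subspace_diff[OF V that x0(2)] by (intro image_eqI[of _ _ "x - x0"]) auto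
    moreover have "(1, x0 + w) \<in> V" if "(0, w) \<in> V" for w
      using subspace_add[OF V x0(2) that] by simp
    ultimately show ?thesis by auto
  qed
  also have "aff_dim \<dots> = aff_dim ?W"
    by (rule aff_dim_translation_eq)
  also have W: "subspace ?W"
  proof -
    have "(0, c *\<^sub>R w) \<in> V" if "(0, w) \<in> V" for c w
      using subspace_scale[OF V that, of c] by simp
    moreover have "(0, v + w) \<in> V" if "(0, v) \<in> V" "(0, w) \<in> V" for v w
      using subspace_add[OF V that] by simp
    moreover have "(0, 0) \<in> V"
      using subspace_0[OF V] by (simp add: zero_prod_def)
    ultimately show ?thesis
      by (simp add: subspace_def)
  qed
  then have "aff_dim ?W = int (dim ?W)"
    by (rule aff_dim_subspace)
  also have "dim V = dim ?W + 1"
  proof -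
    let ?P = "Pair (0::real) ` ?W"
    have lin: "linear (Pair (0::real) :: real ^ 'n \<Rightarrow> _)"
      by (rule linearI) auto
    have P: "span ?P = ?P"
      using linear_subspace_image[OF lin W] by (rule span_eq_iff[THEN iffD2])
    have "span (insert (1, x0) ?P) = V"
    proof
      show "span (insert (1, x0) ?P) \<subseteq> V"
        using x0 V by (intro span_minimal) auto
      show "V \<subseteq> span (insert (1, x0) ?P)"
      proof
        fix u assume u: "u \<in> V"
        have "u - fst u *\<^sub>R (1, x0) = (0, snd u - fst u *\<^sub>R x0)"
          by (simp add: prod_eq_iff)
        moreover have "u - fst u *\<^sub>R (1, x0) \<in> V"
          using V u x0 by (intro subspace_diff subspace_scale)
        ultimately have "u - fst u *\<^sub>R (1, x0) \<in> span ?P"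
          by (auto intro: span_base)
        then show "u \<in> span (insert (1, x0) ?P)"
          using span_breakdown_eq by blast
      qed
    qed
    then have "dim V = dim (insert (1, x0) ?P)"
      by (metis dim_span)
    also have "\<dots> = dim ?P + 1"
      unfolding dim_insert P by auto
    also have "dim ?P = dim ?W"
      by (rule dim_image_eq[OF lin]) (simp add: inj_on_def)
    finally show ?thesis .
  qed
  ultimately show ?thesis by simp
qed

definition lorthonormal :: "(real \<times> (real ^ 'n)) list \<Rightarrow> bool" where
  "lorthonormal as \<longleftrightarrow> distinct as \<and> set as \<subseteq> unit_spacelike \<and>
     (\<forall>a\<in>set as. \<forall>b\<in>set as. a \<noteq> b \<longrightarrow> lform a b = 0)"

lemma lform_sum_lorthonormal:
  assumes "lorthonormal as" "b \<in> set as"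
  shows "lform (\<Sum>a\<in>set as. c a *\<^sub>R a) b = c b"
proof -
  have "lform (\<Sum>a\<in>set as. c a *\<^sub>R a) b = (\<Sum>a\<in>set as. if a = b then c b else 0)"
    unfolding lform_sum_left using assms
    by (intro sum.cong) (auto simp: lorthonormal_def unit_spacelike_def)
  then show ?thesis
    using assms(2) by simp
qed

text \<open>Reflections in pairwise orthogonal vectors do not interact: each subtracts its own
  component twice.\<close>

lemma refl_word_lorthonormal:
  "lorthonormal as \<Longrightarrow> foldr lrefl as u = u - (\<Sum>a\<in>set as. (2 * lform u a) *\<^sub>R a)"
proof (induction as)
  case (Cons b as)
  then have as: "lorthonormal as" and b: "b \<notin> set as"
    by (auto simp: lorthonormal_def)
  have "lform (\<Sum>a\<in>set as. (2 * lform u a) *\<^sub>R a) b = 0"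
    unfolding lform_sum_left using Cons.prems b
    by (intro sum.neutral) (auto simp: lorthonormal_def)
  then show ?case
    using Cons.IH[OF as] b by (simp add: lrefl_def)
qed simp

lemma refl_word_lorthonormal_involution:
  assumes "lorthonormal as"
  shows "foldr lrefl as (foldr lrefl as u) = u"
proof -
  let ?S = "\<lambda>u. \<Sum>a\<in>set as. (2 * lform u a) *\<^sub>R a"
  have "lform (u - ?S u) a = - lform u a" if "a \<in> set as" for a
    using lform_sum_lorthonormal[OF assms that] by simp
  then have "?S (u - ?S u) = - ?S u"
    by (simp add: sum_negf[symmetric] del: lform_simps(3))
  then show ?thesis
    by (simp add: refl_word_lorthonormal[OF assms])
qed

text \<open>The negated vectors are the span of the normal vectors. These are linearly independent
  because a vector in the span of the others would be orthogonal to itself.\<close>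

lemma dim_negated_space_lorthonormal:
  assumes "lorthonormal as"
  shows "dim {u. foldr lrefl as u = - u} = length as"
proof -
  have "{u. foldr lrefl as u = - u} = span (set as)"
  proof
    show "{u. foldr lrefl as u = - u} \<subseteq> span (set as)"
    proof
      fix u assume "u \<in> {u. foldr lrefl as u = - u}"
      then have "2 *\<^sub>R u = (\<Sum>a\<in>set as. (2 * lform u a) *\<^sub>R a)"
        by (simp add: refl_word_lorthonormal[OF assms] scaleR_2 algebra_simps)
      also have "\<dots> \<in> span (set as)"
        by (intro span_sum span_scale span_base)
      finally have "(1/2) *\<^sub>R 2 *\<^sub>R u \<in> span (set as)"
        by (rule span_scale)
      then show "u \<in> span (set as)"
        by simp
    qed
    have "foldr lrefl as b = - b" if b: "b \<in> set as" for b
    proof -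
      have "(\<Sum>a\<in>set as. (2 * lform b a) *\<^sub>R a) = (\<Sum>a\<in>set as. if a = b then 2 *\<^sub>R b else 0)"
        using assms b by (intro sum.cong) (auto simp: lorthonormal_def unit_spacelike_def)
      then show ?thesis
        using b by (simp add: refl_word_lorthonormal[OF assms] scaleR_2)
    qed
    moreover have "linear (foldr lrefl as)"
      using assms by (simp add: lorthonormal_def lorentz_refl_word lorentzD)
    then have "subspace {u. foldr lrefl as u = - u}"
      by (auto simp: subspace_def linear_0 linear_add linear_scale)
    ultimately show "span (set as) \<subseteq> {u. foldr lrefl as u = - u}"
      by (intro span_minimal) auto
  qed
  moreover have "independent (set as)"
  proof
    assume "dependent (set as)"
    then obtain a where a: "a \<in> set as" "a \<in> span (set as - {a})"
      by (auto simp: dependent_def)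
    have "subspace {u. lform u a = 0}"
      by (auto simp: subspace_def)
    then have "span (set as - {a}) \<subseteq> {u. lform u a = 0}"
      using assms a(1) by (intro span_minimal) (auto simp: lorthonormal_def)
    then have "lform a a = 0"
      using a(2) by blast
    moreover have "lform a a = 1"
      using assms a(1) by (auto simp: lorthonormal_def unit_spacelike_def)
    ultimately show False
      by simp
  qed
  ultimately show ?thesis
    using assms by (simp add: dim_eq_card_independent lorthonormal_def distinct_card)
qed

text \<open>The fixed space of the product has codimension \<open>length as\<close> in the Lorentz space, hence
  its slice through the ball has this codimension in the ball.\<close>

lemma klein_lorthonormal_in_involutions:
  fixes as :: "(real \<times> (real ^ 'n)) list"
  assumes as: "lorthonormal as" and "as \<noteq> []"
  shows "klein (foldr lrefl as) \<in> involutions (length as)"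
proof -
  let ?L = "foldr lrefl as"
  let ?V = "{u. ?L u = u}"
  have L: "lorentz ?L"
    using as by (simp add: lorthonormal_def lorentz_refl_word)
  have V: "subspace ?V"
    using lorentzD(1)[OF L] by (auto simp: subspace_def linear_0 linear_add linear_scale)
  have inv: "?L (?L u) = u" for u
    using as by (rule refl_word_lorthonormal_involution)
  have dimV: "dim ?V + length as = CARD('n) + 1"
    using eigenspace_dims_of_linear_involution[OF lorentzD(1)[OF L] inv]
    by (simp add: dim_negated_space_lorthonormal[OF as])
  \<comment> \<open>The vector \<open>(1, 0)\<close> minus its component in the span of \<open>as\<close> is timelike and fixed.\<close>
  obtain x0 where x0: "x0 \<in> hspace" "(1, x0) \<in> ?V"
  proof -
    define u where "u = (1, 0) - (\<Sum>a\<in>set as. lform (1, 0) a *\<^sub>R a)"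
    have orth: "lform u a = 0" if "a \<in> set as" for a
      using lform_sum_lorthonormal[OF as that] by (simp add: u_def)
    have "fst u = 1 + (\<Sum>a\<in>set as. fst a * fst a)"
      by (simp add: u_def fst_sum lform_def sum_negf[symmetric])
    moreover have "0 \<le> (\<Sum>a\<in>set as. fst a * fst a)"
      by (intro sum_nonneg) simp
    ultimately have pos: "1 \<le> fst u" by simp
    have "lform u u = lform (1, 0) u - (\<Sum>a\<in>set as. lform (1, 0) a * lform a u)"
      by (subst (1) u_def) (simp add: lform_sum_left)
    also have "\<dots> = - fst u"
      using orth by (simp add: lform_commute[of _ u]) (simp add: lform_def)
    finally have neg: "lform u u < 0"
      using pos by simp
    have "u \<in> ?V"
      using orth by (simp add: refl_word_lorthonormal[OF as])
    then have "(1 / fst u) *\<^sub>R u \<in> ?V"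
      using V subspace_scale by blast
    also have "(1 / fst u) *\<^sub>R u = (1, proj u)"
      using pos by (simp add: proj_def prod_eq_iff divide_inverse)
    finally show thesis
      using timelike_proj(1)[of u] pos neg that by simp
  qed
  let ?A = "{x. (1, x) \<in> ?V}"
  have A: "affine ?A"
    unfolding affine_def
  proof (intro ballI allI impI)
    fix x y u v assume "x \<in> ?A" "y \<in> ?A" and uv: "u + v = (1::real)"
    then have "u *\<^sub>R (1, x) + v *\<^sub>R (1, y) \<in> ?V"
      using V by (intro subspace_add subspace_scale) auto
    then show "u *\<^sub>R x + v *\<^sub>R y \<in> ?A"
      using uv by simp
  qed
  have "aff_dim ?A = int (dim ?V) - 1"
    using V x0 A by (rule aff_dim_of_geodesic_slice) auto
  then have "aff_dim ?A = int CARD('n) - int (length as)"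
    using dimV by simp
  moreover have "{x \<in> hspace. klein ?L x = x} = ?A \<inter> hspace"
    using klein_fixed_iff[OF L] by auto
  ultimately have "geodesic_subspace_codim (length as) {x \<in> hspace. klein ?L x = x}"
    unfolding geodesic_subspace_codim_def using A x0 by blast
  moreover have "klein ?L \<noteq> klein (\<lambda>u. u)"
  proof
    assume "klein ?L = klein (\<lambda>u. u)"
    then have "?L = (\<lambda>u. u)"
      using L by (intro klein_inj) simp_all
    then have "{u. ?L u = - u} \<subseteq> {0}"
      by (auto simp: prod_eq_iff vec_eq_iff)
    then have "dim {u. ?L u = - u} = 0"
      by simp
    then show False
      using assms(2) by (simp add: dim_negated_space_lorthonormal[OF as])
  qed
  moreover have "klein ?L \<otimes>\<^bsub>Mob\<^esub> klein ?L = klein (\<lambda>u. u)"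
    using inv by (simp add: mult_Mob[OF L L])
  ultimately show ?thesis
    using klein_isometry[OF L] by (simp add: involutions_def)
qed

text \<open>The auxiliary normal vectors are taken with time coordinate \<open>0\<close>, where the Lorentz form
  is the Euclidean inner product; this avoids any case distinction on the signature of the plane
  spanned by \<open>a\<close> and \<open>b\<close>. The orthogonal complement of the two space parts has dimension at
  least \<open>n - 2 \<ge> k - 1\<close>.\<close>

lemma two_reflections_eq_two_involutions:
  fixes a b :: "real \<times> (real ^ 'n)"
  assumes ab: "a \<in> unit_spacelike" "b \<in> unit_spacelike" and k: "1 \<le> k" "k + 1 \<le> CARD('n)"
  obtains f g where "f \<in> involutions k" "g \<in> involutions k"
    "f \<otimes>\<^bsub>Mob\<^esub> g = klein (\<lambda>u. lrefl a (lrefl b u))"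
proof -
  let ?A = "span {snd a, snd b}"
  define U where "U = {y \<in> UNIV. \<forall>x \<in> ?A. orthogonal x y}"
  have "dim U + dim ?A = dim (UNIV :: (real ^ 'n) set)"
    unfolding U_def by (rule dim_subspace_orthogonal_to_vectors) auto
  moreover have "dim ?A \<le> 2"
    using dim_le_card'[of "{snd a, snd b}"] card_insert_le_m1[of 2 "{snd b}" "snd a"] by simp
  ultimately have dimU: "k - 1 \<le> dim U"
    using k by simp
  have U: "subspace U"
    using subspace_orthogonal_to_vectors[of ?A] by (simp add: U_def)
  obtain B where B: "B \<subseteq> U" "pairwise orthogonal B" "\<And>x. x \<in> B \<Longrightarrow> norm x = 1"
    "independent B" "card B = dim U" "span B = U"
    by (rule orthonormal_basis_subspace[OF U]) (rule that; blast)
  obtain C where C: "C \<subseteq> B" "card C = k - 1" "finite C"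
    using obtain_subset_with_card_n[of "k - 1" B] dimU B(5) by auto
  obtain vs where vs: "set vs = C" "distinct vs"
    using finite_distinct_list[OF C(3)] by blast
  define ws where "ws = map (Pair (0::real)) vs"
  have len: "length ws = k - 1"
    using vs C(2) distinct_card[of vs] by (simp add: ws_def)
  have dist: "distinct ws"
    using vs by (simp add: ws_def distinct_map inj_on_def)
  have ws_unit: "set ws \<subseteq> unit_spacelike"
  proof -
    have "v \<bullet> v = 1" if "v \<in> C" for v
      using B(3) C(1) that by (metis norm_eq_1 subsetD)
    then show ?thesis
      by (auto simp: ws_def unit_spacelike_def lform_def vs)
  qed
  have ws_orth: "lform w w' = 0" if "w \<in> set ws" "w' \<in> set ws" "w \<noteq> w'" for w w'
    using that B(2) C(1)
    by (auto simp: ws_def vs lform_def pairwise_def orthogonal_def) (metis subsetD)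
  have ws_ab: "lform c w = 0" "lform w c = 0" if w: "w \<in> set ws" "c = a \<or> c = b" for w c
  proof -
    obtain v where v: "w = (0, v)" "v \<in> C"
      using w(1) by (auto simp: ws_def vs)
    have "v \<in> U"
      using v(2) B(1) C(1) by blast
    then have "snd c \<bullet> v = 0"
      using that(2) span_base[of "snd c" "{snd a, snd b}"] by (auto simp: U_def orthogonal_def)
    then show "lform c w = 0" "lform w c = 0"
      by (simp_all add: v(1) lform_def inner_commute)
  qed
  have notin: "a \<notin> set ws" "b \<notin> set ws"
    using ws_ab(1)[of a a] ws_ab(1)[of b b] ab by (auto simp: unit_spacelike_def)
  have on: "lorthonormal (a # ws)" "lorthonormal (ws @ [b])" "lorthonormal ws"
    using ws_unit ws_orth ws_ab ab dist notin by (auto simp: lorthonormal_def)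
  have inv: "klein (foldr lrefl (a # ws)) \<in> involutions k"
    "klein (foldr lrefl (ws @ [b])) \<in> involutions k"
    using klein_lorthonormal_in_involutions[OF on(1)] klein_lorthonormal_in_involutions[OF on(2)]
      len k(1) by simp_all
  have "foldr lrefl (a # ws) (foldr lrefl (ws @ [b]) u) = lrefl a (lrefl b u)" for u
    using refl_word_lorthonormal_involution[OF on(3)] by simp
  moreover have "lorentz (foldr lrefl (a # ws))" "lorentz (foldr lrefl (ws @ [b]))"
    by (rule lorentz_refl_word, use ws_unit ab in simp)+
  ultimately have "klein (foldr lrefl (a # ws)) \<otimes>\<^bsub>Mob\<^esub> klein (foldr lrefl (ws @ [b]))
      = klein (\<lambda>u. lrefl a (lrefl b u))"
    by (simp only: mult_Mob)
  then show ?thesis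
    using inv that by blast
qed

lemma even_refl_word_eq_involution_word:
  fixes as :: "(real \<times> (real ^ 'n)) list"
  assumes k: "1 \<le> k" "k + 1 \<le> CARD('n)"
  shows "set as \<subseteq> unit_spacelike \<Longrightarrow> even (length as) \<Longrightarrow>
    \<exists>xs \<in> lists (involutions k). length xs = length as \<and>
      foldr (mult Mob) xs (one Mob) = klein (foldr lrefl as)"
proof (induction as rule: induct_list012)
  case 1
  then show ?case
    by (intro bexI[of _ "[]"]) (simp_all add: id_def)
next
  case (2 a)
  then show ?case by simp
next
  case (3 a b as)
  then obtain xs where xs: "xs \<in> lists (involutions k)" "length xs = length as"
    "foldr (mult Mob) xs (one Mob) = klein (foldr lrefl as)"
    by auto
  have ab: "a \<in> unit_spacelike" "b \<in> unit_spacelike"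
    using 3 by auto
  obtain f g where fg: "f \<in> involutions k" "g \<in> involutions k"
    "f \<otimes>\<^bsub>Mob\<^esub> g = klein (\<lambda>u. lrefl a (lrefl b u))"
    using two_reflections_eq_two_involutions[OF ab k] by metis
  interpret M: group "Mob :: (real ^ 'n \<Rightarrow> real ^ 'n) monoid"
    by (rule group_Mob)
  have L: "lorentz (foldr lrefl as)" "lorentz (\<lambda>u. lrefl a (lrefl b u))"
    using 3 lorentz_refl_word[of as] lorentz_comp[OF lorentz_lrefl[OF ab(1)] lorentz_lrefl[OF ab(2)]]
    by auto
  have "foldr (mult Mob) (f # g # xs) (one Mob) = f \<otimes>\<^bsub>Mob\<^esub> (g \<otimes>\<^bsub>Mob\<^esub> klein (foldr lrefl as))"
    by (simp add: xs(3) del: Mob_simps)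
  also have "\<dots> = (f \<otimes>\<^bsub>Mob\<^esub> g) \<otimes>\<^bsub>Mob\<^esub> klein (foldr lrefl as)"
    using fg L(1) klein_isometry by (intro M.m_assoc[symmetric]) (auto simp: involutions_def)
  also have "\<dots> = klein (\<lambda>u. lrefl a (lrefl b (foldr lrefl as u)))"
    by (simp add: fg(3) mult_Mob[OF L(2,1)])
  also have "(\<lambda>u. lrefl a (lrefl b (foldr lrefl as u))) = foldr lrefl (a # b # as)"
    by (simp add: fun_eq_iff)
  finally show ?case
    using xs(1,2) fg(1,2) by (intro bexI[of _ "f # g # xs"]) auto
qed

lemma spacelike_if_orthogonal_to_timelike:
  fixes u :: "real \<times> (real ^ 'n)"
  assumes "x \<in> hspace" "lform u (1, x) = 0" "u \<noteq> 0"
  shows "0 < lform u u"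
proof -
  have s: "fst u = snd u \<bullet> x"
    using assms(2) by (simp add: lform_def)
  have "snd u \<noteq> 0"
    using s assms(3) by (auto simp: prod_eq_iff)
  have "(fst u)\<^sup>2 \<le> (snd u \<bullet> snd u) * (x \<bullet> x)"
    unfolding s by (rule Cauchy_Schwarz_ineq)
  also have "\<dots> < (snd u \<bullet> snd u) * 1"
    using assms(1) \<open>snd u \<noteq> 0\<close> by (intro mult_strict_left_mono) (auto simp: mem_hspace)
  finally show ?thesis
    by (simp add: lform_def power2_eq_square)
qed

text \<open>A vector \<open>c\<close> with \<open>L c = - c\<close> is orthogonal to the fixed timelike vector \<open>(1, x)\<close>, hence
  spacelike. The product of \<open>L\<close> and the reflection in \<open>c\<close> is an involution again, and its
  negated space is smaller by one dimension.\<close>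

lemma lorentz_involution_eq_refl_word:
  fixes L :: "real \<times> (real ^ 'n) \<Rightarrow> real \<times> (real ^ 'n)"
  assumes "lorentz L" "\<And>u. L (L u) = u" "x \<in> hspace" "L (1, x) = (1, x)"
    "dim {u. L u = - u} = k"
  shows "\<exists>as. set as \<subseteq> unit_spacelike \<and> length as = k \<and> L = foldr lrefl as"
  using assms
proof (induction k arbitrary: L)
  case 0
  have "L u = u" for u
  proof -
    have "u - L u \<in> {u. L u = - u}"
      using 0 by (simp add: lorentzD(1) linear_diff)
    moreover have "{u. L u = - u} \<subseteq> {0}"
      using 0 by (simp only: dim_eq_0)
    ultimately have "u - L u = 0"
      by blast
    then show ?thesis by simp
  qed
  then show ?case
    by (intro exI[of _ "[]"]) auto
next
  case (Suc k)
  note L = \<open>lorentz L\<close> and inv = \<open>\<And>u. L (L u) = u\<close>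
  have lin: "linear L"
    using L by (rule lorentzD)
  have "\<not> {u. L u = - u} \<subseteq> {0}"
    using Suc.prems(5) by (metis dim_eq_0 nat.distinct(1))
  then obtain c where c: "L c = - c" "c \<noteq> 0"
    by blast
  have "lform c (1, x) = lform (L c) (L (1, x))"
    using L by (simp only: lorentzD)
  then have "lform c (1, x) = 0"
    by (simp add: c(1) Suc.prems(4))
  then have pos: "0 < lform c c"
    using c(2) Suc.prems(3) by (intro spacelike_if_orthogonal_to_timelike)
  define a where "a = (1 / sqrt (lform c c)) *\<^sub>R c"
  have a: "a \<in> unit_spacelike" and La: "L a = - a"
    using pos by (simp_all add: a_def unit_spacelike_def linear_scale[OF lin] c(1))
  have ax: "lform (1, x) a = 0"
    using \<open>lform c (1, x) = 0\<close> by (simp add: a_def lform_commute[of "(1, x)"])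
  let ?M = "\<lambda>u. lrefl a (L u)"
  have M: "lorentz ?M"
    using lorentz_lrefl[OF a] L by (rule lorentz_comp)
  have La_form: "lform (L u) a = - lform u a" for u
    using lorentzD(2)[OF L, of u a] by (simp add: La)
  have comm: "L (lrefl a u) = lrefl a (L u)" for u
    by (simp add: lrefl_def La_form linear_diff[OF lin] linear_scale[OF lin] La)
  have "?M (?M u) = u" for u
    by (simp add: comm lrefl_lrefl[OF a] inv)
  moreover have "?M (1, x) = (1, x)"
    using ax by (simp add: Suc.prems(4) lrefl_orthogonal)
  moreover have "dim {u. ?M u = - u} = k"
  proof -
    let ?V = "{u. L u = - u}" and ?W = "{u. ?M u = - u}"
    have W: "?W = {u. L u = - u \<and> lform u a = 0}"
    proof -
      have "L u = - u \<and> lform u a = 0" if "?M u = - u" for u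
      proof -
        have "?M a = a"
          by (simp add: La linear_neg[OF linear_lrefl] lrefl_self[OF a])
        then have "lform u a = - lform u a"
          using lorentzD(2)[OF M, of u a] that by simp
        then have "lform u a = 0" by simp
        moreover have "L u = lrefl a (- u)"
          using lrefl_lrefl[OF a, of "L u"] that by simp
        ultimately show ?thesis
          by (simp add: lrefl_def)
      qed
      moreover have "?M u = - u" if "L u = - u" "lform u a = 0" for u
        using that by (simp add: lrefl_def)
      ultimately show ?thesis by blast
    qed
    have subW: "subspace ?W"
      unfolding W using lin by (auto simp: subspace_def linear_0 linear_add linear_scale)
    have subV: "subspace ?V"
      using lin by (auto simp: subspace_def linear_0 linear_add linear_scale)
    have "span (insert a ?W) = ?V"
    proof
      show "span (insert a ?W) \<subseteq> ?V"
        using subV by (intro span_minimal) (auto simp: W La)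
      show "?V \<subseteq> span (insert a ?W)"
      proof
        fix u assume u: "u \<in> ?V"
        have "u - lform u a *\<^sub>R a \<in> ?W"
          unfolding W using u a
          by (simp add: linear_diff[OF lin] linear_scale[OF lin] La unit_spacelike_def)
        then have "u - lform u a *\<^sub>R a \<in> span ?W"
          by (rule span_base)
        then show "u \<in> span (insert a ?W)"
          using span_breakdown_eq by blast
      qed
    qed
    then have "dim ?V = dim (insert a ?W)"
      using dim_span[of "insert a ?W"] by (simp only:)
    moreover have "a \<notin> span ?W"
      unfolding span_eq_iff[THEN iffD2, OF subW] using a by (auto simp: W unit_spacelike_def)
    ultimately show ?thesis
      using Suc.prems(5) by (simp add: dim_insert)
  qed
  ultimately obtain as where as: "set as \<subseteq> unit_spacelike" "length as = k" "?M = foldr lrefl as"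
    using Suc.IH[OF M] Suc.prems(3) by blast
  have "L u = foldr lrefl (a # as) u" for u
    using fun_cong[OF as(3), of u] lrefl_lrefl[OF a, of "L u"] by simp
  then have "L = foldr lrefl (a # as)"
    by blast
  then show ?case
    using as(1,2) a by (intro exI[of _ "a # as"]) auto
qed

text \<open>The square of the linear map acts trivially on the ball, so it is the identity, and the
  codimension of the fixed set gives the dimensions of the two eigenspaces.\<close>

lemma involution_structure:
  fixes f :: "real ^ 'n \<Rightarrow> real ^ 'n"
  assumes f: "f \<in> involutions k" and k: "k \<le> CARD('n)"
  obtains as where "set as \<subseteq> unit_spacelike" "length as = k" "f = klein (foldr lrefl as)"
    "\<And>u. foldr lrefl as (foldr lrefl as u) = u"
    "dim {u. foldr lrefl as u = u} + k = CARD('n) + 1"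
    "dim {u. foldr lrefl as u = - u} = k"
proof -
  have "f \<in> hisometries" and ff: "f \<otimes>\<^bsub>Mob\<^esub> f = klein (\<lambda>u. u)"
    and geo: "geodesic_subspace_codim k {x \<in> hspace. f x = x}"
    using f by (auto simp: involutions_def)
  then obtain bs where bs: "set bs \<subseteq> unit_spacelike" "f = klein (foldr lrefl bs)"
    using isometry_is_product_of_reflections by metis
  let ?L = "foldr lrefl bs"
  let ?V = "{u. ?L u = u}"
  have L: "lorentz ?L"
    using bs(1) by (rule lorentz_refl_word)
  have "klein (\<lambda>u. ?L (?L u)) = klein (\<lambda>u. u)"
    using ff by (simp add: bs(2) mult_Mob[OF L L])
  then have "(\<lambda>u. ?L (?L u)) = (\<lambda>u. u)"
    by (rule klein_inj[OF lorentz_comp[OF L L] lorentz_id])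
  then have inv: "?L (?L u) = u" for u
    by (rule fun_cong)
  obtain A where A: "affine A" "aff_dim A = int CARD('n) - int k" "A \<inter> hspace \<noteq> {}"
    "{x \<in> hspace. f x = x} = A \<inter> hspace"
    using geo by (auto simp: geodesic_subspace_codim_def)
  have fix_eq: "A \<inter> hspace = {x \<in> hspace. (1, x) \<in> ?V}"
    unfolding A(4)[symmetric] bs(2) using klein_fixed_iff[OF L] by auto
  then obtain x where x: "x \<in> hspace" "(1, x) \<in> ?V"
    using A(3) by blast
  have "subspace ?V"
    using lorentzD(1)[OF L] by (auto simp: subspace_def linear_0 linear_add linear_scale)
  then have "aff_dim A = int (dim ?V) - 1"
    using x A(1) fix_eq by (rule aff_dim_of_geodesic_slice)
  then have dims: "dim ?V + k = CARD('n) + 1" "dim {u. ?L u = - u} = k"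
    using A(2) k eigenspace_dims_of_linear_involution[OF lorentzD(1)[OF L] inv] by simp_all
  obtain as where as: "set as \<subseteq> unit_spacelike" "length as = k" "?L = foldr lrefl as"
    using lorentz_involution_eq_refl_word[OF L inv x(1) _ dims(2)] x(2) by blast
  then show ?thesis
    using that[OF as(1,2)] bs(2) inv dims unfolding as(3) by blast
qed

section \<open>A lower bound for words in involutions\<close>

lemma dim_Int_ge:
  fixes S T :: "(real \<times> (real ^ 'n)) set"
  assumes "subspace S" "subspace T"
  shows "dim S + dim T \<le> dim (S \<inter> T) + (CARD('n) + 1)"
  using dim_sums_Int[OF assms] dim_subset_UNIV[of "{x + y |x y. x \<in> S \<and> y \<in> T}"] by simp

lemma subspace_eigenspace:
  assumes "linear (L :: 'a :: real_vector \<Rightarrow> 'a)"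
  shows "subspace {u. L u = c *\<^sub>R u}"
  using assms by (auto simp: subspace_def linear_0 linear_add linear_scale algebra_simps)

text \<open>Each factor contributes its codimension: the common fixed vectors of the factors are
  fixed by the product, and the vectors negated by all factors are multiplied by \<open>(-1)\<^sup>m\<close>.\<close>

lemma involution_word_eigenspaces:
  fixes xs :: "(real ^ 'n \<Rightarrow> real ^ 'n) list"
  assumes "xs \<in> lists (involutions k)" and k: "k \<le> CARD('n)"
  shows "\<exists>L. lorentz L \<and> foldr (mult Mob) xs (one Mob) = klein L \<and>
    CARD('n) + 1 \<le> dim {u. L u = 1 *\<^sub>R u} + length xs * k \<and>
    CARD('n) + 1 \<le> dim {u. L u = (-1) ^ length xs *\<^sub>R u} + length xs * (CARD('n) + 1 - k)"
  using assms(1)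
proof (induction xs)
  case Nil
  show ?case
    by (intro exI[of _ "\<lambda>u. u"]) (simp add: lorentz_id)
next
  case (Cons f xs)
  let ?m = "length xs"
  obtain L where L: "lorentz L" "foldr (mult Mob) xs (one Mob) = klein L"
    "CARD('n) + 1 \<le> dim {u. L u = 1 *\<^sub>R u} + ?m * k"
    "CARD('n) + 1 \<le> dim {u. L u = (-1) ^ ?m *\<^sub>R u} + ?m * (CARD('n) + 1 - k)"
    using Cons by auto
  have f: "f \<in> involutions k"
    by (rule Cons.hyps)
  obtain as where as: "set as \<subseteq> unit_spacelike" "length as = k" "f = klein (foldr lrefl as)"
    "\<And>u. foldr lrefl as (foldr lrefl as u) = u"
    "dim {u. foldr lrefl as u = u} + k = CARD('n) + 1"
    "dim {u. foldr lrefl as u = - u} = k"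
    by (rule involution_structure[OF f k]) (rule that; blast)
  define A where "A = foldr lrefl as"
  have A: "lorentz A" unfolding A_def using as(1) by (rule lorentz_refl_word)
  have linA: "linear A" and linL: "linear L"
    using A L(1) by (auto intro: lorentzD)
  let ?M = "\<lambda>u. A (L u)"
  have "{u. A u = 1 *\<^sub>R u} \<inter> {u. L u = 1 *\<^sub>R u} \<subseteq> {u. ?M u = 1 *\<^sub>R u}"
    by auto
  then have "dim ({u. A u = 1 *\<^sub>R u} \<inter> {u. L u = 1 *\<^sub>R u}) \<le> dim {u. ?M u = 1 *\<^sub>R u}"
    by (rule dim_subset)
  then have 1: "CARD('n) + 1 \<le> dim {u. ?M u = 1 *\<^sub>R u} + Suc ?m * k"
    using dim_Int_ge[OF subspace_eigenspace[OF linA, of 1] subspace_eigenspace[OF linL, of 1]]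
      L(3) as(5) by (simp add: A_def)
  have "{u. A u = (-1) *\<^sub>R u} \<inter> {u. L u = (-1) ^ ?m *\<^sub>R u} \<subseteq> {u. ?M u = (-1) ^ Suc ?m *\<^sub>R u}"
  proof
    fix u assume "u \<in> {u. A u = (-1) *\<^sub>R u} \<inter> {u. L u = (-1) ^ ?m *\<^sub>R u}"
    then have "A (L u) = (-1) ^ ?m *\<^sub>R A u" "A u = - u"
      by (simp_all add: linear_scale[OF linA])
    then show "u \<in> {u. ?M u = (-1) ^ Suc ?m *\<^sub>R u}"
      by simp
  qed
  then have "dim ({u. A u = (-1) *\<^sub>R u} \<inter> {u. L u = (-1) ^ ?m *\<^sub>R u})
      \<le> dim {u. ?M u = (-1) ^ Suc ?m *\<^sub>R u}"
    by (rule dim_subset)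
  then have 2: "CARD('n) + 1 \<le> dim {u. ?M u = (-1) ^ Suc ?m *\<^sub>R u} + Suc ?m * (CARD('n) + 1 - k)"
    using dim_Int_ge[OF subspace_eigenspace[OF linA, of "-1"]
        subspace_eigenspace[OF linL, of "(-1) ^ ?m"]] L(4) as(6) k
    by (simp add: A_def)
  have "foldr (mult Mob) (f # xs) (one Mob) = klein ?M"
    using L(2) by (simp add: as(3) A_def[symmetric] mult_Mob[OF A L(1)])
  then show ?case
    using lorentz_comp[OF A L(1)] 1 2 by (intro exI[of _ ?M]) simp
qed

text \<open>Neighbours in the list are swapped by \<open>\<sigma>\<close>, and \<open>\<epsilon>\<close> has the values \<open>1\<close> and \<open>-1\<close> on such a
  pair. If the length is odd, the last element \<open>j\<close> remains unpaired. The equation \<open>\<epsilon> (\<sigma> i) = - \<epsilon>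
  i\<close> forces \<open>\<epsilon>\<close> to vanish at the fixed points of \<open>\<sigma>\<close>.\<close>

lemma pairing_exists:
  fixes xs :: "'a list"
  assumes "distinct xs"
  shows "\<exists>(\<sigma> :: 'a \<Rightarrow> 'a) (\<epsilon> :: 'a \<Rightarrow> real) j.
     (\<forall>i. \<sigma> (\<sigma> i) = i \<and> \<epsilon> (\<sigma> i) = - \<epsilon> i \<and> (\<sigma> i \<noteq> i \<longrightarrow> \<epsilon> i * \<epsilon> i = 1)) \<and>
     (\<forall>i \<in> set xs. \<sigma> i = i \<longrightarrow> i = j) \<and> (\<forall>i. i \<notin> set xs \<longrightarrow> \<sigma> i = i)"
  using assms
proof (induction xs rule: induct_list012)
  case 1
  show ?case by (intro exI[of _ "\<lambda>i. i"] exI[of _ "\<lambda>_. 0"]) simp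
next
  case (2 x)
  show ?case by (intro exI[of _ "\<lambda>i. i"] exI[of _ "\<lambda>_. 0"]) simp
next
  case (3 x y xs)
  have xy: "x \<noteq> y" "x \<notin> set xs" "y \<notin> set xs" "distinct xs"
    using 3(3) by auto
  obtain \<sigma> :: "'a \<Rightarrow> 'a" and \<epsilon> :: "'a \<Rightarrow> real" and j
    where IH: "\<forall>i. \<sigma> (\<sigma> i) = i \<and> \<epsilon> (\<sigma> i) = - \<epsilon> i \<and> (\<sigma> i \<noteq> i \<longrightarrow> \<epsilon> i * \<epsilon> i = 1)"
      "\<forall>i \<in> set xs. \<sigma> i = i \<longrightarrow> i = j" "\<forall>i. i \<notin> set xs \<longrightarrow> \<sigma> i = i"
    using 3(1)[OF xy(4)] by blast
  have fix_xy: "\<sigma> x = x" "\<sigma> y = y"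
    using xy IH(3) by auto
  have ne: "\<sigma> i \<noteq> x" "\<sigma> i \<noteq> y" if "i \<noteq> x" "i \<noteq> y" for i
    using IH(1) fix_xy that by metis+
  let ?\<sigma> = "\<sigma>(x := y, y := x)" and ?\<epsilon> = "\<epsilon>(x := 1, y := -1)"
  have "?\<sigma> (?\<sigma> i) = i \<and> ?\<epsilon> (?\<sigma> i) = - ?\<epsilon> i \<and> (?\<sigma> i \<noteq> i \<longrightarrow> ?\<epsilon> i * ?\<epsilon> i = 1)" for i
    using xy IH(1) ne[of i] by (cases "i = x"; cases "i = y") auto
  moreover have "\<forall>i \<in> set (x # y # xs). ?\<sigma> i = i \<longrightarrow> i = j"
    using xy IH(2) by auto
  moreover have "\<forall>i. i \<notin> set (x # y # xs) \<longrightarrow> ?\<sigma> i = i"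
    using IH(3) by auto
  ultimately show ?case by blast
qed

text \<open>The coefficients \<open>5/4\<close> and \<open>3/4\<close> are a rational hyperbolic cosine and sine.\<close>

lemma lorentz_boost:
  fixes k :: "'n :: finite"
  shows "lorentz (\<lambda>u. (5/4 * fst u + 3/4 * snd u $ k,
                       snd u + (3/4 * fst u + 1/4 * snd u $ k) *\<^sub>R axis k 1))"
    (is "lorentz ?L")
proof -
  have "linear ?L"
    by (rule linearI) (simp_all add: algebra_simps add_divide_distrib)
  moreover have "lform (?L u) (?L w) = lform u w" for u w
    by (simp add: lform_def inner_add_left inner_add_right inner_axis inner_axis' inner_axis_axis
        algebra_simps)
  moreover have "0 < fst (?L (1, x))" if "x \<in> hspace" for x
    using that component_le_norm_cart[of x k] by (simp add: hspace_def)
  ultimately show ?thesis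
    unfolding lorentz_def by blast
qed

text \<open>A simultaneous rotation, with cosine \<open>3/5\<close> and sine \<open>4/5\<close>, in the coordinate planes
  given by the pairing \<open>\<sigma>\<close>. The change of the summand \<open>i\<close> of the inner product is antisymmetric
  under \<open>\<sigma>\<close>, so the changes cancel in the sum.\<close>

lemma lorentz_rotation:
  fixes \<sigma> :: "'n :: finite \<Rightarrow> 'n" and \<epsilon> :: "'n \<Rightarrow> real"
  assumes \<sigma>: "\<And>i. \<sigma> (\<sigma> i) = i" and \<epsilon>: "\<And>i. \<epsilon> (\<sigma> i) = - \<epsilon> i"
    and unit: "\<And>i. \<sigma> i \<noteq> i \<Longrightarrow> \<epsilon> i * \<epsilon> i = 1"
  shows "lorentz (\<lambda>u. (fst u, \<chi> i. if \<sigma> i = i then snd u $ i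
                                  else 3/5 * snd u $ i + 4/5 * \<epsilon> i * snd u $ \<sigma> i))"
    (is "lorentz (\<lambda>u. (fst u, \<chi> i. ?r u i))")
proof -
  have "linear (\<lambda>u. (fst u, \<chi> i. ?r u i))"
    by (rule linearI) (auto simp: vec_eq_iff algebra_simps)
  moreover have "lform (fst u, \<chi> i. ?r u i) (fst w, \<chi> i. ?r w i) = lform u w" for u w
  proof -
    let ?d = "\<lambda>i. ?r u i * ?r w i - snd u $ i * snd w $ i"
    have anti: "?d (\<sigma> i) = - ?d i" for i
    proof (cases "\<sigma> i = i")
      case False
      then have "\<sigma> (\<sigma> i) \<noteq> \<sigma> i" "\<epsilon> i = 1 \<or> \<epsilon> i = -1"
        using \<sigma>[of i] unit[OF False] by (auto simp: square_eq_1_iff)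
      then show ?thesis
        using False by (auto simp: \<sigma> \<epsilon> field_simps)
    qed simp
    have "bij \<sigma>"
      using \<sigma> by (rule involuntory_imp_bij)
    then have "sum ?d UNIV = (\<Sum>i\<in>UNIV. ?d (\<sigma> i))"
      by (rule sum.reindex_bij_betw[symmetric])
    then have "sum ?d UNIV = - sum ?d UNIV"
      by (simp only: anti sum_negf)
    then have "sum ?d UNIV = 0"
      by simp
    then have "(\<Sum>i\<in>UNIV. ?r u i * ?r w i) = (\<Sum>i\<in>UNIV. snd u $ i * snd w $ i)"
      by (simp add: sum_subtractf)
    then show ?thesis
      by (simp add: lform_def inner_vec_def)
  qed
  ultimately show ?thesis
    unfolding lorentz_def by simp
qed

text \<open>The boost along one axis leaves \<open>n - 1\<close> coordinates, which are rotated in pairs; for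
  even \<open>n\<close> one coordinate is left over, and its axis contains all eigenvectors for \<open>1\<close> or \<open>-1\<close>.
  Taking the square makes the isometry orientation preserving without any computation of a
  determinant. The angle is such that the squared rotation has no real eigenvalues.\<close>

lemma exists_isometry_with_small_eigenspaces:
  obtains G :: "real \<times> (real ^ 'n) \<Rightarrow> real \<times> (real ^ 'n)" where "lorentz G" "klein G \<in> Mob_plus"
    "dim {u. G u = 1 *\<^sub>R u} \<le> 1" "dim {u. G u = (-1) *\<^sub>R u} \<le> 1"
proof -
  fix k :: 'n
  obtain xs where xs: "set xs = UNIV - {k}" "distinct xs"
    using finite_distinct_list[of "UNIV - {k}"] by auto
  obtain \<sigma> :: "'n \<Rightarrow> 'n" and \<epsilon> :: "'n \<Rightarrow> real" and j
    where pairing: "\<forall>i. \<sigma> (\<sigma> i) = i \<and> \<epsilon> (\<sigma> i) = - \<epsilon> i \<and> (\<sigma> i \<noteq> i \<longrightarrow> \<epsilon> i * \<epsilon> i = 1)"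
      "\<forall>i \<in> set xs. \<sigma> i = i \<longrightarrow> i = j" "\<forall>i. i \<notin> set xs \<longrightarrow> \<sigma> i = i"
    using pairing_exists[OF xs(2)] by blast
  have \<sigma>: "\<sigma> (\<sigma> i) = i" "\<epsilon> (\<sigma> i) = - \<epsilon> i" "\<sigma> i \<noteq> i \<Longrightarrow> \<epsilon> i * \<epsilon> i = 1"
    "i \<noteq> k \<Longrightarrow> \<sigma> i = i \<Longrightarrow> i = j" "\<sigma> k = k" for i
    using pairing xs(1) by auto
  define B where "B = (\<lambda>u. (5/4 * fst u + 3/4 * snd u $ k,
                       snd u + (3/4 * fst u + 1/4 * snd u $ k) *\<^sub>R axis k 1))"
  define R where "R = (\<lambda>u :: real \<times> (real ^ 'n). (fst u, \<chi> i. if \<sigma> i = i then snd u $ i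
                                  else 3/5 * snd u $ i + 4/5 * \<epsilon> i * snd u $ \<sigma> i))"
  define H where "H = (\<lambda>u. B (R u))"
  have H: "lorentz H"
    unfolding H_def B_def R_def
    using lorentz_boost lorentz_rotation[of \<sigma> \<epsilon>, OF \<sigma>(1-3)] by (rule lorentz_comp)
  have fstH: "fst (H u) = 5/4 * fst u + 3/4 * snd u $ k" for u
    by (simp add: H_def B_def R_def \<sigma>(5))
  have Hk: "snd (H u) $ k = 3/4 * fst u + 5/4 * snd u $ k" for u
    by (simp add: H_def B_def R_def \<sigma>(5) axis_def)
  have Hi: "snd (H u) $ i = 3/5 * snd u $ i + 4/5 * \<epsilon> i * snd u $ \<sigma> i" if "\<sigma> i \<noteq> i" for u i
    using that \<sigma>(5) by (auto simp: H_def B_def R_def axis_def)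
  have small: "dim {u. H (H u) = s *\<^sub>R u} \<le> 1" if s: "s = 1 \<or> s = -1" for s :: real
  proof -
    have "u \<in> span {(0, axis j 1)}" if u: "H (H u) = s *\<^sub>R u" for u
    proof -
      \<comment> \<open>On the plane of the boost, \<open>H \<circ> H\<close> has the eigenvalues \<open>4\<close> and \<open>1/4\<close>.\<close>
      have "4 * (fst u + snd u $ k) = s * (fst u + snd u $ k)"
        "1/4 * (fst u - snd u $ k) = s * (fst u - snd u $ k)"
        using arg_cong[OF u, of fst] arg_cong[OF u, of "\<lambda>u. snd u $ k"]
        by (simp_all add: fstH Hk algebra_simps)
      then have "fst u + snd u $ k = 0" "fst u - snd u $ k = 0"
        using s by auto
      then have 0: "fst u = 0" "snd u $ k = 0"
        by simp_all
      have "snd u $ i = 0" if "\<sigma> i \<noteq> i" for i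
      proof -
        have i': "\<sigma> (\<sigma> i) \<noteq> \<sigma> i" using that \<sigma>(1)[of i] by auto
        let ?p = "snd u $ i" and ?q = "snd u $ \<sigma> i"
        let ?a = "s + 7/25" and ?b = "24/25 * \<epsilon> i"
        have \<epsilon>\<epsilon>: "\<epsilon> i * (\<epsilon> i * z) = z" for z
          using \<sigma>(3)[OF that] by (simp flip: mult.assoc)
        \<comment> \<open>The squared rotation has cosine \<open>- 7/25\<close> and sine \<open>24/25\<close>.\<close>
        have "3/5 * (3/5 * ?p + 4/5 * \<epsilon> i * ?q) + 4/5 * \<epsilon> i * (3/5 * ?q - 4/5 * \<epsilon> i * ?p) = s * ?p"
          "3/5 * (3/5 * ?q - 4/5 * \<epsilon> i * ?p) - 4/5 * \<epsilon> i * (3/5 * ?p + 4/5 * \<epsilon> i * ?q) = s * ?q"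
          using arg_cong[OF u, of "\<lambda>u. snd u $ i"] arg_cong[OF u, of "\<lambda>u. snd u $ \<sigma> i"]
          by (simp_all add: Hi[OF that] Hi[OF i'] \<sigma>(1,2))
        then have ab: "?a * ?p = ?b * ?q" "?a * ?q = - (?b * ?p)"
          by (simp_all add: algebra_simps \<epsilon>\<epsilon>)
        have "?a * (?a * ?p) = ?b * (?a * ?q)"
          unfolding ab(1) by (simp only: mult.left_commute)
        then have "?a * (?a * ?p) + ?b * (?b * ?p) = 0"
          unfolding ab(2) by (simp only: mult_minus_right add.left_inverse)
        then have "(?a * ?a + ?b * ?b) * ?p = 0"
          by (simp only: distrib_right mult.assoc)
        moreover have "0 < ?a * ?a"
          using s by auto
        then have "0 < ?a * ?a + ?b * ?b"
          by (rule add_pos_nonneg) simp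
        ultimately show ?thesis
          by (metis mult_eq_0_iff less_irrefl)
      qed
      then have "snd u $ i = 0" if "i \<noteq> j" for i
        using that 0(2) \<sigma>(4)[of i] by (cases "i = k"; cases "\<sigma> i = i") auto
      then have "u = (snd u $ j) *\<^sub>R (0, axis j 1)"
        using 0(1) by (auto simp: prod_eq_iff vec_eq_iff axis_def)
      then show ?thesis
        by (metis span_base span_scale singletonI)
    qed
    then have "dim {u. H (H u) = s *\<^sub>R u} \<le> card {(0 :: real, axis j (1 :: real))}"
      by (intro dim_le_card) auto
    then show ?thesis by simp
  qed
  obtain as where as: "set as \<subseteq> unit_spacelike" "klein H = klein (foldr lrefl as)"
    using isometry_is_product_of_reflections[OF klein_isometry[OF H]] by metis
  have "H = foldr lrefl as"
    using klein_inj[OF H lorentz_refl_word[OF as(1)] as(2)] .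
  then have "(\<lambda>u. H (H u)) = (\<lambda>u. foldr lrefl as (foldr lrefl as u))"
    by (simp only:)
  also have "\<dots> = foldr lrefl (as @ as)"
    by (simp add: fun_eq_iff)
  finally have "(\<lambda>u. H (H u)) = foldr lrefl (as @ as)" .
  moreover have "klein (foldr lrefl (as @ as)) \<in> Mob_plus"
    using as(1) by (subst refl_word_in_Mob_plus) auto
  ultimately have "klein (\<lambda>u. H (H u)) \<in> Mob_plus"
    by (simp only:)
  from that[OF lorentz_comp[OF H H] this small[of 1] small[of "-1"]] show ?thesis
    by simp
qed

text \<open>Both \<open>n \<le> m k\<close> and \<open>n \<le> m (n + 1 - k)\<close> hold. The first is used if \<open>n + 1 \<le> 2 (n + 1 -
  k)\<close>, the second if \<open>n + 1 \<le> 2 k\<close>.\<close>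

lemma involution_word_length_ge:
  fixes G :: "real \<times> (real ^ 'n) \<Rightarrow> real \<times> (real ^ 'n)"
  assumes G: "lorentz G" "dim {u. G u = 1 *\<^sub>R u} \<le> 1" "dim {u. G u = (-1) *\<^sub>R u} \<le> 1"
    and xs: "xs \<in> lists (involutions k)" "foldr (mult Mob) xs (one Mob) = klein G"
    and k: "1 \<le> k" "k \<le> CARD('n)"
  shows "real (CARD('n) * (CARD('n) + 1)) / real (2 * k * (CARD('n) - k + 1)) \<le> real (length xs)"
proof -
  let ?n = "CARD('n)" and ?m = "length xs"
  obtain L where L: "lorentz L" "foldr (mult Mob) xs (one Mob) = klein L"
    "?n + 1 \<le> dim {u. L u = 1 *\<^sub>R u} + ?m * k"
    "?n + 1 \<le> dim {u. L u = (-1) ^ ?m *\<^sub>R u} + ?m * (?n + 1 - k)"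
    using involution_word_eigenspaces[OF xs(1) k(2)] by blast
  have "L = G"
    using L(1,2) G(1) xs(2) by (intro klein_inj) auto
  moreover have "(-1 :: real) ^ ?m = 1 \<or> (-1 :: real) ^ ?m = -1"
    by (cases "even ?m") auto
  ultimately have bounds: "?n \<le> ?m * k" "?n \<le> ?m * (?n + 1 - k)"
    using L(3,4) G(2,3) by auto
  have "?n * (?n + 1) \<le> ?m * (2 * k * (?n - k + 1))"
  proof (cases "2 * k \<le> ?n + 1")
    case True
    then have "?n * (?n + 1) \<le> (?m * k) * (2 * (?n - k + 1))"
      using bounds(1) k by (intro mult_le_mono) auto
    then show ?thesis
      by (simp only: mult_ac)
  next
    case False
    then have "?n * (?n + 1) \<le> (?m * (?n + 1 - k)) * (2 * k)"
      using bounds(2) by (intro mult_le_mono) auto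
    moreover have "?n + 1 - k = ?n - k + 1"
      using k by simp
    ultimately show ?thesis
      by (simp only: mult_ac)
  qed
  then have "real (?n * (?n + 1)) \<le> real ?m * real (2 * k * (?n - k + 1))"
    by (metis of_nat_le_iff of_nat_mult)
  moreover have "0 < 2 * k * (?n - k + 1)"
    using k by simp
  then have "0 < real (2 * k * (?n - k + 1))"
    by (simp only: of_nat_0_less_iff)
  ultimately show ?thesis
    by (simp only: pos_divide_le_eq)
qed

section \<open>Generation and word length\<close>

lemma ereal_le_word_length:
  assumes "\<And>xs. xs \<in> lists S \<Longrightarrow> foldr (mult M) xs (one M) = g \<Longrightarrow> b \<le> real (length xs)"
  shows "ereal b \<le> ereal_of_enat (word_length M S g)"
proof -
  have "nat \<lceil>b\<rceil> \<le> length xs" if "xs \<in> lists S" "foldr (mult M) xs (one M) = g" for xs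
    using assms[OF that] by (simp add: nat_le_iff ceiling_le_iff)
  then have "enat (nat \<lceil>b\<rceil>) \<le> word_length M S g"
    unfolding word_length_def by (intro INF_greatest) auto
  moreover have "b \<le> real (nat \<lceil>b\<rceil>)"
    by (rule real_nat_ceiling_ge)
  ultimately show ?thesis
    by (cases "word_length M S g") (auto intro: order_trans)
qed

lemma word_length_le:
  "xs \<in> lists S \<Longrightarrow> foldr (mult M) xs (one M) = g \<Longrightarrow> word_length M S g \<le> enat (length xs)"
  unfolding word_length_def by (rule INF_lower) simp

lemma word_in_generate: "xs \<in> lists S \<Longrightarrow> foldr (mult M) xs (one M) \<in> generate M S"
  by (induction xs) (auto intro: generate.intros)

lemma Mob_plus_refl_word:
  fixes f :: "real ^ 'n \<Rightarrow> real ^ 'n"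
  assumes "f \<in> Mob_plus"
  obtains as where "set as \<subseteq> unit_spacelike" "even (length as)" "length as \<le> CARD('n) + 1"
    "f = klein (foldr lrefl as)"
proof -
  have "f \<in> hisometries"
    using assms by (simp add: Mob_plus_def)
  then obtain as where "set as \<subseteq> unit_spacelike" "length as \<le> CARD('n) + 1"
    "f = klein (foldr lrefl as)"
    by (rule isometry_is_product_of_reflections)
  then show ?thesis
    using that assms refl_word_in_Mob_plus by blast
qed

lemma mult_klein_refl_word:
  assumes "set as \<subseteq> unit_spacelike" "set bs \<subseteq> unit_spacelike"
  shows "klein (foldr lrefl as) \<otimes>\<^bsub>Mob\<^esub> klein (foldr lrefl bs) = klein (foldr lrefl (as @ bs))"
proof -
  have "(\<lambda>u. foldr lrefl as (foldr lrefl bs u)) = foldr lrefl (as @ bs)"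
    by (simp add: fun_eq_iff)
  then show ?thesis
    using mult_Mob[OF lorentz_refl_word[OF assms(1)] lorentz_refl_word[OF assms(2)]] by simp
qed

lemma Mob_plus_subset_generate:
  assumes "1 \<le> k" "k + 1 \<le> CARD('n)"
  shows "(Mob_plus :: (real ^ 'n \<Rightarrow> real ^ 'n) set) \<subseteq> generate Mob (involutions k)"
proof
  fix f :: "real ^ 'n \<Rightarrow> real ^ 'n"
  assume "f \<in> Mob_plus"
  then obtain as where as: "set as \<subseteq> unit_spacelike" "even (length as)" "f = klein (foldr lrefl as)"
    by (rule Mob_plus_refl_word)
  then obtain xs where "xs \<in> lists (involutions k)" "foldr (mult Mob) xs (one Mob) = f"
    using even_refl_word_eq_involution_word[OF assms as(1,2)] by auto
  then show "f \<in> generate Mob (involutions k)"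
    using word_in_generate by metis
qed

lemma involutions_subset_Mob: "involutions k \<subseteq> carrier Mob"
  by (auto simp: involutions_def)

lemma generate_even:
  assumes "1 \<le> k" "k + 1 \<le> CARD('n)" "even k"
  shows "generate (Mob :: (real ^ 'n \<Rightarrow> real ^ 'n) monoid) (involutions k) = Mob_plus"
proof
  interpret M: group "Mob :: (real ^ 'n \<Rightarrow> real ^ 'n) monoid"
    by (rule group_Mob)
  have inv_plus: "f \<in> Mob_plus" if f: "f \<in> involutions k" for f :: "real ^ 'n \<Rightarrow> real ^ 'n"
  proof -
    obtain as where "set as \<subseteq> unit_spacelike" "length as = k" "f = klein (foldr lrefl as)"
      by (rule involution_structure[OF f]) (use assms(2) in auto)
    then show ?thesis
      using assms(3) by (simp add: refl_word_in_Mob_plus)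
  qed
  show "generate Mob (involutions k) \<subseteq> (Mob_plus :: (real ^ 'n \<Rightarrow> real ^ 'n) set)"
  proof
    fix f :: "real ^ 'n \<Rightarrow> real ^ 'n"
    assume "f \<in> generate Mob (involutions k)"
    then show "f \<in> Mob_plus"
    proof (induction rule: generate.induct)
      case one
      show ?case
        using refl_word_in_Mob_plus[of "[]"] by (simp add: id_def)
    next
      case (incl f)
      then show ?case by (rule inv_plus)
    next
      case (inv f)
      then have "inv\<^bsub>Mob\<^esub> f = f"
        using involutions_subset_Mob[of k]
        by (intro M.inv_equality) (auto simp: involutions_def)
      then show ?case
        using inv_plus inv by simp
    next
      case (eng f g)
      obtain as where as: "set as \<subseteq> unit_spacelike" "even (length as)" "f = klein (foldr lrefl as)"
        using eng.IH(1) by (rule Mob_plus_refl_word)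
      obtain bs where bs: "set bs \<subseteq> unit_spacelike" "even (length bs)" "g = klein (foldr lrefl bs)"
        using eng.IH(2) by (rule Mob_plus_refl_word)
      have "f \<otimes>\<^bsub>Mob\<^esub> g = klein (foldr lrefl (as @ bs))"
        by (simp only: as(3) bs(3) mult_klein_refl_word[OF as(1) bs(1)])
      moreover have "klein (foldr lrefl (as @ bs)) \<in> Mob_plus"
        using as bs by (subst refl_word_in_Mob_plus) auto
      ultimately show ?case by simp
    qed
  qed
  show "(Mob_plus :: (real ^ 'n \<Rightarrow> real ^ 'n) set) \<subseteq> generate Mob (involutions k)"
    using assms(1,2) by (rule Mob_plus_subset_generate)
qed

text \<open>An orientation reversing \<open>f\<close> is \<open>(f g) g\<close> for any \<open>k\<close>-involution \<open>g\<close>, and \<open>f g\<close>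
  preserves the orientation because \<open>g\<close> is a product of an odd number of reflections.\<close>

lemma generate_odd:
  assumes "1 \<le> k" "k + 1 \<le> CARD('n)" "odd k"
  shows "generate (Mob :: (real ^ 'n \<Rightarrow> real ^ 'n) monoid) (involutions k) = carrier Mob"
proof
  interpret M: group "Mob :: (real ^ 'n \<Rightarrow> real ^ 'n) monoid"
    by (rule group_Mob)
  show "generate (Mob :: (real ^ 'n \<Rightarrow> real ^ 'n) monoid) (involutions k) \<subseteq> carrier Mob"
    using involutions_subset_Mob by (rule M.generate_incl)
  show "carrier (Mob :: (real ^ 'n \<Rightarrow> real ^ 'n) monoid) \<subseteq> generate Mob (involutions k)"
  proof
    fix f :: "real ^ 'n \<Rightarrow> real ^ 'n"
    assume f: "f \<in> carrier Mob"
    then obtain as where as: "set as \<subseteq> unit_spacelike" "f = klein (foldr lrefl as)"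
      using isometry_is_product_of_reflections[of f] by auto
    have "f \<in> Mob_plus \<Longrightarrow> f \<in> generate Mob (involutions k)"
      using Mob_plus_subset_generate[OF assms(1,2)] by blast
    moreover have "f \<in> generate Mob (involutions k)" if "odd (length as)"
    proof -
      have a: "(0, axis undefined 1) \<in> (unit_spacelike :: (real \<times> (real ^ 'n)) set)"
        by (simp add: unit_spacelike_def lform_def inner_axis_axis)
      obtain g :: "real ^ 'n \<Rightarrow> real ^ 'n" where g: "g \<in> involutions k"
        by (rule two_reflections_eq_two_involutions[OF a a assms(1,2)])
      obtain bs where bs: "set bs \<subseteq> unit_spacelike" "length bs = k" "g = klein (foldr lrefl bs)"
        by (rule involution_structure[OF g]) (use assms(2) in auto)
      have "klein (foldr lrefl (as @ bs)) \<in> Mob_plus"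
        using as(1) bs(1,2) assms(3) that by (subst refl_word_in_Mob_plus) auto
      then have "f \<otimes>\<^bsub>Mob\<^esub> g \<in> generate Mob (involutions k)"
        unfolding as(2) bs(3) mult_klein_refl_word[OF as(1) bs(1)]
        by (rule subsetD[OF Mob_plus_subset_generate[OF assms(1,2)]])
      then have "(f \<otimes>\<^bsub>Mob\<^esub> g) \<otimes>\<^bsub>Mob\<^esub> g \<in> generate Mob (involutions k)"
        by (rule generate.eng[OF _ generate.incl[OF g]])
      moreover have "(f \<otimes>\<^bsub>Mob\<^esub> g) \<otimes>\<^bsub>Mob\<^esub> g = f"
      proof -
        have "g \<in> carrier Mob" "g \<otimes>\<^bsub>Mob\<^esub> g = \<one>\<^bsub>Mob\<^esub>"
          using g by (auto simp: involutions_def)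
        then show ?thesis
          using f M.m_assoc[of f g g] M.r_one[of f] by metis
      qed
      ultimately show ?thesis by simp
    qed
    ultimately show "f \<in> generate Mob (involutions k)"
      using as refl_word_in_Mob_plus by blast
  qed
qed

lemma set_length_Mob_plus_le:
  assumes "1 \<le> k" "k + 1 \<le> CARD('n)"
  shows "set_length (Mob :: (real ^ 'n \<Rightarrow> real ^ 'n) monoid) (involutions k) Mob_plus
           \<le> enat (CARD('n) + 1)"
  unfolding set_length_def
proof (rule SUP_least)
  fix f :: "real ^ 'n \<Rightarrow> real ^ 'n"
  assume "f \<in> Mob_plus"
  then obtain as where as: "set as \<subseteq> unit_spacelike" "even (length as)" "length as \<le> CARD('n) + 1"
    "f = klein (foldr lrefl as)"
    by (rule Mob_plus_refl_word)
  then obtain xs where "xs \<in> lists (involutions k)" "length xs = length as"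
    "foldr (mult Mob) xs (one Mob) = f"
    using even_refl_word_eq_involution_word[OF assms as(1,2)] by auto
  then have "word_length Mob (involutions k) f \<le> enat (length as)"
    using word_length_le by metis
  also have "\<dots> \<le> enat (CARD('n) + 1)"
    using as(3) by simp
  finally show "word_length Mob (involutions k) f \<le> enat (CARD('n) + 1)" .
qed

lemma set_length_Mob_plus_ge:
  assumes "1 \<le> k" "k + 1 \<le> CARD('n)"
  shows "ereal (real (CARD('n) * (CARD('n) + 1)) / real (2 * k * (CARD('n) - k + 1)))
    \<le> ereal_of_enat (set_length (Mob :: (real ^ 'n \<Rightarrow> real ^ 'n) monoid) (involutions k) Mob_plus)"
proof -
  obtain G :: "real \<times> (real ^ 'n) \<Rightarrow> real \<times> (real ^ 'n)" where G: "lorentz G" "klein G \<in> Mob_plus"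
    "dim {u. G u = 1 *\<^sub>R u} \<le> 1" "dim {u. G u = (-1) *\<^sub>R u} \<le> 1"
    by (rule exists_isometry_with_small_eigenspaces)
  have "ereal (real (CARD('n) * (CARD('n) + 1)) / real (2 * k * (CARD('n) - k + 1)))
      \<le> ereal_of_enat (word_length Mob (involutions k) (klein G))"
    using involution_word_length_ge[OF G(1,3,4)] assms by (intro ereal_le_word_length) simp
  also have "\<dots> \<le> ereal_of_enat
      (set_length (Mob :: (real ^ 'n \<Rightarrow> real ^ 'n) monoid) (involutions k) Mob_plus)"
    unfolding set_length_def ereal_of_enat_le_iff using G(2) by (rule SUP_upper)
  finally show ?thesis .
qed

theorem theorem1p1:
  fixes n k :: nat
  assumes "n = CARD('n::finite)" and "n \<ge> 2" and "k \<in> {1..n - 1}"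
  shows
    "(even k \<longrightarrow>
        generate (Mob :: (real ^ 'n \<Rightarrow> real ^ 'n) monoid) (involutions k) = Mob_plus \<and>
        ereal (real (n * (n + 1)) / real (2 * k * (n - k + 1)))
          \<le> ereal_of_enat
              (set_length (Mob :: (real ^ 'n \<Rightarrow> real ^ 'n) monoid) (involutions k) Mob_plus) \<and>
        set_length (Mob :: (real ^ 'n \<Rightarrow> real ^ 'n) monoid) (involutions k) Mob_plus
          \<le> enat (2 * n + 4))
     \<and>
     (odd k \<longrightarrow>
        generate (Mob :: (real ^ 'n \<Rightarrow> real ^ 'n) monoid) (involutions k) = carrier Mob \<and>
        ereal (real (n * (n + 1)) / real (2 * k * (n - k + 1)))
          \<le> ereal_of_enat
              (set_length (Mob :: (real ^ 'n \<Rightarrow> real ^ 'n) monoid) (involutions k) Mob_plus) \<and>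
        set_length (Mob :: (real ^ 'n \<Rightarrow> real ^ 'n) monoid) (involutions k) Mob_plus
          \<le> enat (2 * n + 2 + k))"
proof -
  let ?len = "set_length (Mob :: (real ^ 'n \<Rightarrow> real ^ 'n) monoid) (involutions k) Mob_plus"
  have k: "1 \<le> k" "k + 1 \<le> CARD('n)"
    using assms by auto
  have "?len \<le> enat (n + 1)"
    using set_length_Mob_plus_le[OF k] by (simp only: assms(1))
  moreover have "enat (n + 1) \<le> enat (2 * n + 4)" "enat (n + 1) \<le> enat (2 * n + 2 + k)"
    by simp_all
  ultimately have "?len \<le> enat (2 * n + 4)" "?len \<le> enat (2 * n + 2 + k)"
    by (blast intro: order_trans)+
  then show ?thesis
    using generate_even[OF k] generate_odd[OF k] set_length_Mob_plus_ge[OF k]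
    unfolding assms(1) by blast
qed

end
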